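(* Let $A$ be a $C^*$-algebra, let $H_0,H_1,H$ be Hilbert $A$-modules such that $H_0\subset H_1$ (as a Hilbert $A$-submodule), and let $\phi: H_0\to H$ be a bounded module map. Then, for any $\epsilon>0$ and any finite subset $\mathcal F\subset H_0$, there exists a bounded module map $\psi: H_1\to H$ such that $\|\psi\|\le\|\phi\|$ and $$\|\psi(x)-\phi(x)\|<\epsilon\quad\text{for all } x\in\mathcal F.$$ If, in addition, $H_0$ is countably generated, then there exist bounded module maps $\psi_n: H_1\to H$, $n\in\mathbb N$, such that $\|\psi_n\|\le\|\phi\|$ for all $n$ and $$\lim_{n\to\infty}\|\psi_n(x)-\phi(x)\|=0\quad\text{for all } x\in H_0.$$
   Context: Hilbert $A$-modules are right Hilbert $A$-modules. A bounded module map is a bounded $A$-linear map, not assumed to have an adjoint. A Hilbert $A$-module $H$ is countably generated if there is a countable subset $\mathcal G\subset H$ such that the linear span of $\{za: z\in\mathcal G, a\in A\}$ is norm dense in $H$. *)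

theory Defs
  imports "HOL-Analysis.Analysis"
begin

class complex_vector = real_vector +
  fixes scaleC :: "complex \<Rightarrow> 'a \<Rightarrow> 'a"  (infixr \<open>*\<^sub>C\<close> 75)
  assumes scaleC_add_right: "c *\<^sub>C (x + y) = c *\<^sub>C x + c *\<^sub>C y"
    and scaleC_add_left: "(c + d) *\<^sub>C x = c *\<^sub>C x + d *\<^sub>C x"
    and scaleC_scaleC: "c *\<^sub>C (d *\<^sub>C x) = (c * d) *\<^sub>C x"
    and scaleC_one: "1 *\<^sub>C x = x"
    and scaleR_scaleC: "r *\<^sub>R x = complex_of_real r *\<^sub>C x"

text \<open>C*-algebras, not assumed to be unital; the zero algebra is included.\<close>

class cstar_algebra = complex_vector + real_normed_algebra + banach +
  fixes star :: "'a \<Rightarrow> 'a"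
  assumes norm_scaleC: "norm (c *\<^sub>C x) = cmod c * norm x"
    and mult_scaleC_left: "(c *\<^sub>C x) * y = c *\<^sub>C (x * y)"
    and mult_scaleC_right: "x * (c *\<^sub>C y) = c *\<^sub>C (x * y)"
    and star_add: "star (x + y) = star x + star y"
    and star_scaleC: "star (c *\<^sub>C x) = cnj c *\<^sub>C star x"
    and star_mult: "star (x * y) = star y * star x"
    and star_star: "star (star x) = x"
    and norm_star_mult: "norm (star x * x) = (norm x)\<^sup>2"

definition cstar_positive :: "'a::cstar_algebra \<Rightarrow> bool" where
  "cstar_positive a \<longleftrightarrow> (\<exists>b. a = star b * b)"

text \<open>
  Right Hilbert modules over the C*-algebra \<open>'a\<close>. The inner product is conjugate linear in
  the first argument and linear in the second. Completeness is the sort \<open>banach\<close> of \<open>'h\<close>,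
  whose norm is tied to the inner product by \<open>norm_ip\<close>; this also gives definiteness.
\<close>

locale hilbert_module =
  fixes act :: "'h::{banach, complex_vector} \<Rightarrow> 'a::cstar_algebra \<Rightarrow> 'h"
    and ip :: "'h \<Rightarrow> 'h \<Rightarrow> 'a"
  assumes act_add_left: "act (x + y) a = act x a + act y a"
    and act_add_right: "act x (a + b) = act x a + act x b"
    and act_mult: "act x (a * b) = act (act x a) b"
    and act_scaleC_left: "act (c *\<^sub>C x) a = c *\<^sub>C act x a"
    and act_scaleC_right: "act x (c *\<^sub>C a) = c *\<^sub>C act x a"
    and ip_add_right: "ip x (y + z) = ip x y + ip x z"
    and ip_scaleC_right: "ip x (c *\<^sub>C y) = c *\<^sub>C ip x y"
    and ip_act_right: "ip x (act y a) = ip x y * a"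
    and star_ip: "star (ip x y) = ip y x"
    and ip_positive: "cstar_positive (ip x x)"
    and norm_ip: "norm x = sqrt (norm (ip x x))"

text \<open>
  Hilbert submodules: subsets which are Hilbert modules for the restricted operations,
  inner product and norm. For a subset of a complete space, completeness means closedness.
\<close>

definition hilbert_submodule ::
    "('h::{banach, complex_vector} \<Rightarrow> 'a::cstar_algebra \<Rightarrow> 'h) \<Rightarrow> 'h set \<Rightarrow> bool" where
  "hilbert_submodule act S \<longleftrightarrow>
     0 \<in> S \<and> (\<forall>x\<in>S. \<forall>y\<in>S. x + y \<in> S) \<and> (\<forall>c. \<forall>x\<in>S. c *\<^sub>C x \<in> S) \<and>
     (\<forall>x\<in>S. \<forall>a. act x a \<in> S) \<and> closed S"

text \<open>
  Bounded module maps with domain \<open>S\<close>; the values outside \<open>S\<close> are irrelevant.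
  No adjoint is required.
\<close>

definition bounded_module_map_on ::
    "('h::{banach, complex_vector} \<Rightarrow> 'a::cstar_algebra \<Rightarrow> 'h) \<Rightarrow>
     ('k::{banach, complex_vector} \<Rightarrow> 'a \<Rightarrow> 'k) \<Rightarrow> 'h set \<Rightarrow> ('h \<Rightarrow> 'k) \<Rightarrow> bool" where
  "bounded_module_map_on act act' S f \<longleftrightarrow>
     (\<forall>x\<in>S. \<forall>y\<in>S. f (x + y) = f x + f y) \<and>
     (\<forall>c. \<forall>x\<in>S. f (c *\<^sub>C x) = c *\<^sub>C f x) \<and>
     (\<forall>x\<in>S. \<forall>a. f (act x a) = act' (f x) a) \<and>
     (\<exists>K. \<forall>x\<in>S. norm (f x) \<le> K * norm x)"

text \<open>The operator norm of a map with domain \<open>S\<close>, following \<^const>\<open>onorm\<close>.\<close>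

definition onorm_on :: "'h::real_normed_vector set \<Rightarrow> ('h \<Rightarrow> 'k::real_normed_vector) \<Rightarrow> real" where
  "onorm_on S f = (SUP x\<in>S. norm (f x) / norm x)"

definition countably_generated ::
    "('h::{banach, complex_vector} \<Rightarrow> 'a::cstar_algebra \<Rightarrow> 'h) \<Rightarrow> 'h set \<Rightarrow> bool" where
  "countably_generated act S \<longleftrightarrow>
     (\<exists>G\<subseteq>S. countable G \<and> S \<subseteq> closure (module.span scaleC {act z a |z a. z \<in> G}))"

end

(*
  Finite-rank approximate units. For a finite F in H0 put h y = t * sum_{x in F} x <x, y> with t
  so small that 0 <= h <= 1 (Cauchy-Schwarz), and g = 1 - h. Then e_n = 1 - g^(2n) is a
  contractive module map from H1 into H0, and e_n x -> x for x in F because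
  n * g^n h g^n <= 1. So phi o e_n extends phi approximately without increasing its norm; if H0
  is countably generated, a diagonal choice over the generators gives convergence on all of H0.
  The operator inequalities only use that sums of elements b^* b of a C*-algebra are positive and
  that the norm is monotone on positive elements. Both are obtained in the unitization, where
  positive elements are the squares of self-adjoint ones, by Kaplansky's argument.
*)
theory Submission
  imports Defs
begin

text \<open>\<open>H0\<close> need not be complemented in \<open>H1\<close> and
  \<open>\<phi>\<close> need not have an adjoint, so there may be no projection onto
  \<open>H0\<close> to compose with and no extension by duality. What is available is adjointable
  operators built from finitely many vectors of \<open>H0\<close>: their ranges lie in
  \<open>H0\<close>, where \<open>\<phi>\<close> is defined, so \<open>\<phi>\<close> only has to be
  bounded. Polynomials in \<open>h\<close> without constant term take the place of functional
  calculus such as h (h + 1/n)^-1, and inequalities between operators are read as inequalities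
  between values such as \<open>ip x (h x)\<close> in the algebra. Neither inverses nor a C*-algebra
  of operators on \<open>H1\<close> enter. Cauchy-Schwarz has to hold in the order of the algebra,
  not just in norm, because it must yield h <= 1; this is what brings in the order theory. Closure
  under sums is not evident from the existential form of \<open>cstar_positive\<close>, and square
  roots are expanded around 1, which a nonunital algebra lacks.\<close>

interpretation complex_module: module "scaleC :: complex \<Rightarrow> 'a::complex_vector \<Rightarrow> 'a"
  by standard (simp_all add: scaleC_add_right scaleC_add_left scaleC_scaleC scaleC_one)

lemma scaleC_scaleR_commute: "c *\<^sub>C (r *\<^sub>R x) = r *\<^sub>R (c *\<^sub>C x)" for x :: "'a::complex_vector"
  by (simp add: scaleR_scaleC mult.commute)

lemma norm_star [simp]: "norm (star x) = norm x" for x :: "'a::cstar_algebra"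
proof -
  have le: "norm y \<le> norm (star y)" for y :: 'a
  proof (cases "y = 0")
    case False
    have "norm y * norm y \<le> norm (star y) * norm y"
      using norm_mult_ineq[of "star y" y] by (simp add: norm_star_mult power2_eq_square)
    then show ?thesis using False by simp
  qed simp
  show ?thesis using le[of x] le[of "star x"] by (simp add: star_star)
qed

lemma star_zero [simp]: "star 0 = (0 :: 'a::cstar_algebra)"
  using norm_star[of "0 :: 'a"] by (simp del: norm_star)

lemma star_minus: "star (- x) = - star x" for x :: "'a::cstar_algebra"
  using star_add[of x "- x"] by (simp add: eq_neg_iff_add_eq_0 add.commute)

lemma star_diff: "star (x - y) = star x - star y" for x :: "'a::cstar_algebra"
  using star_add[of x "- y"] by (simp add: star_minus)

lemma star_scaleR: "star (r *\<^sub>R x) = r *\<^sub>R star x" for x :: "'a::cstar_algebra"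
  by (simp add: scaleR_scaleC star_scaleC)

lemma bounded_linear_star: "bounded_linear (star :: 'a::cstar_algebra \<Rightarrow> 'a)"
  by (rule bounded_linear_intro[where K = 1]) (simp_all add: star_add star_scaleR)

section \<open>Positivity in unital C*-algebras\<close>

class unital_cstar_algebra = cstar_algebra + real_normed_algebra_1

lemma star_one [simp]: "star 1 = (1 :: 'a::unital_cstar_algebra)"
  by (metis mult_1_left mult_1_right star_mult star_star)

lemma star_power: "star (x ^ n) = star x ^ n" for x :: "'a::unital_cstar_algebra"
  by (induction n) (simp_all add: star_mult power_commutes)

text \<open>Each squaring squares the norm by the C*-identity. Combined with a growth bound on
  powers, this does the work of the spectral radius formula.\<close>

lemma norm_power_two_power:
  fixes x :: "'a::unital_cstar_algebra"
  assumes "star x = x"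
  shows "norm (x ^ (2 ^ k)) = norm x ^ (2 ^ k)"
proof (induction k)
  case (Suc k)
  have "norm (x ^ 2 ^ Suc k) = norm (star (x ^ 2 ^ k) * x ^ 2 ^ k)"
    using assms by (simp add: star_power flip: power_add mult_2)
  also have "\<dots> = (norm x ^ 2 ^ k)\<^sup>2"
    by (simp add: norm_star_mult Suc)
  finally show ?case by (simp add: mult.commute flip: power_mult)
qed simp

text \<open>For \<open>y = 1 - d\<close> the equation \<open>d\<^sup>2 = 1 - x\<close> reads \<open>y = (x + y\<^sup>2) / 2\<close>. Its iteration
  from \<open>0\<close> is dominated, increment by increment, by the scalar iteration for \<open>x = 1\<close>.\<close>

lemma sqrt_one_minus:
  fixes x :: "'a::unital_cstar_algebra"
  assumes x: "star x = x" "norm x \<le> 1"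
  obtains d where "star d = d" "d * d = 1 - x" "\<And>z. x * z = z * x \<Longrightarrow> d * z = z * d"
    "norm (1 - d) \<le> 1"
proof -
  define y where "y n = ((\<lambda>w. (1/2) *\<^sub>R (x + w * w)) ^^ n) 0" for n
  define t :: "nat \<Rightarrow> real" where "t n = ((\<lambda>s. (1 + s * s) / 2) ^^ n) 0" for n
  have y0: "y 0 = 0" and ySuc: "y (Suc n) = (1/2) *\<^sub>R (x + y n * y n)" for n
    by (simp_all add: y_def)
  have t0: "t 0 = 0" and tSuc: "t (Suc n) = (1 + t n * t n) / 2" for n
    by (simp_all add: t_def)
  have comm: "y n * z = z * y n" if "x * z = z * x" for n z
  proof (induction n)
    case (Suc n)
    have "y n * y n * z = z * (y n * y n)"
      by (metis Suc mult.assoc)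
    with that show ?case by (simp add: ySuc algebra_simps)
  qed (simp add: y0)
  have star_y: "star (y n) = y n" for n
    by (induction n) (simp_all add: y0 ySuc star_scaleR star_add star_mult x)
  have t01: "0 \<le> t n \<and> t n \<le> 1" for n
  proof (induction n)
    case (Suc n)
    then have "t n * t n \<le> 1" by (simp add: mult_le_one)
    then show ?case by (simp add: tSuc)
  qed (simp add: t0)
  have norm_y: "norm (y n) \<le> t n" for n
  proof (induction n)
    case (Suc n)
    have "norm (x + y n * y n) \<le> norm x + norm (y n) * norm (y n)"
      by (rule order_trans[OF norm_triangle_ineq]) (simp add: norm_mult_ineq)
    also have "\<dots> \<le> 1 + t n * t n"
      using x Suc t01[of n] by (intro add_mono mult_mono) auto
    finally show ?case by (simp add: ySuc tSuc)
  qed (simp add: y0 t0)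
  have incr: "norm (y (Suc n) - y n) \<le> t (Suc n) - t n" for n
  proof (induction n)
    case 0
    then show ?case using x by (simp add: ySuc tSuc y0 t0)
  next
    case (Suc n)
    \<comment> \<open>All iterates commute, being polynomials in \<open>x\<close>, so the difference
      of consecutive squares factors.\<close>
    have "x * y n = y n * x" using comm[of x n] by simp
    then have c: "y n * y (Suc n) = y (Suc n) * y n" using comm[of "y n" "Suc n"] by simp
    have "y (Suc (Suc n)) - y (Suc n) = (1/2) *\<^sub>R ((y (Suc n) - y n) * (y (Suc n) + y n))"
      unfolding ySuc[of "Suc n"] using c by (simp add: ySuc[of n] algebra_simps)
    then have "norm (y (Suc (Suc n)) - y (Suc n))
        \<le> (norm (y (Suc n) - y n) * norm (y (Suc n) + y n)) / 2"
      by (simp add: norm_mult_ineq)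
    also have "\<dots> \<le> ((t (Suc n) - t n) * (t (Suc n) + t n)) / 2"
    proof -
      have "norm (y (Suc n) + y n) \<le> t (Suc n) + t n"
        using norm_triangle_ineq[of "y (Suc n)" "y n"] norm_y[of n] norm_y[of "Suc n"] by linarith
      moreover have "0 \<le> t (Suc n) - t n" using Suc norm_ge_zero order_trans by blast
      ultimately show ?thesis using Suc by (intro divide_right_mono mult_mono) auto
    qed
    also have "\<dots> = t (Suc (Suc n)) - t (Suc n)"
      by (simp add: tSuc[of "Suc n"] tSuc[of n] field_simps)
    finally show ?case .
  qed
  have "incseq t"
  proof (rule incseq_SucI)
    show "t n \<le> t (Suc n)" for n using incr[of n] norm_ge_zero[of "y (Suc n) - y n"] by linarith
  qed
  then obtain l where "t \<longlonglongrightarrow> l" using incseq_convergent[of t 1] t01 by blast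
  then have "summable (\<lambda>n. t (Suc n) - t n)" by (rule telescope_summable)
  then have "summable (\<lambda>n. y (Suc n) - y n)"
    by (rule summable_comparison_test[rotated]) (use incr in blast)
  then have "convergent (\<lambda>n. \<Sum>i<n. y (Suc i) - y i)"
    by (simp add: summable_iff_convergent)
  then obtain Y where Y: "y \<longlonglongrightarrow> Y"
    unfolding sum_lessThan_telescope y0 by (auto simp: convergent_def)
  have "(\<lambda>n. (1/2) *\<^sub>R (x + y n * y n)) \<longlonglongrightarrow> (1/2) *\<^sub>R (x + Y * Y)"
    by (intro tendsto_intros Y)
  moreover have "(\<lambda>n. (1/2) *\<^sub>R (x + y n * y n)) \<longlonglongrightarrow> Y"
    using LIMSEQ_Suc[OF Y] by (simp add: ySuc)
  ultimately have fix_Y: "(1/2) *\<^sub>R (x + Y * Y) = Y" using LIMSEQ_unique by blast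
  have "2 *\<^sub>R ((1/2) *\<^sub>R (x + Y * Y)) = 2 *\<^sub>R Y" using fix_Y by simp
  then have "x + Y * Y = Y + Y" by (simp add: scaleR_2)
  then have sq: "(1 - Y) * (1 - Y) = 1 - x" by (simp add: algebra_simps)
  have "(\<lambda>n. star (y n)) \<longlonglongrightarrow> star Y"
    by (rule bounded_linear.tendsto[OF bounded_linear_star Y])
  then have "y \<longlonglongrightarrow> star Y" by (simp add: star_y)
  then have "star Y = Y" using Y by (rule LIMSEQ_unique)
  then have "star (1 - Y) = 1 - Y" by (simp add: star_diff)
  moreover have "(1 - Y) * z = z * (1 - Y)" if "x * z = z * x" for z
  proof -
    have "(\<lambda>n. y n * z) \<longlonglongrightarrow> Y * z" "(\<lambda>n. z * y n) \<longlonglongrightarrow> z * Y"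
      by (intro tendsto_intros Y)+
    then have "Y * z = z * Y" using comm[OF that] by (simp add: LIMSEQ_unique)
    then show ?thesis by (simp add: algebra_simps)
  qed
  moreover
  have "norm Y \<le> 1"
    by (rule LIMSEQ_le_const2[OF tendsto_norm[OF Y]]) (use norm_y t01 order_trans in blast)
  then have "norm (1 - (1 - Y)) \<le> 1" by simp
  ultimately show thesis using sq that by blast
qed

text \<open>\<open>c\<close> is the real part of the normal element c + i d, whose squared norm is
  \<open>t\<close> by the C*-identity. This replaces a spectral argument for commuting
  squares.\<close>

lemma norm_square_le_of_sum_squares:
  fixes c d :: "'a::unital_cstar_algebra"
  assumes "star c = c" "star d = d" "c * d = d * c" "c * c + d * d = of_real t" "t \<ge> 0"
  shows "(norm c)\<^sup>2 \<le> t"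
proof -
  define u where "u = c + \<i> *\<^sub>C d"
  have su: "star u = c - \<i> *\<^sub>C d"
    by (simp add: u_def star_add star_scaleC assms complex_module.scale_minus_left)
  have "star u * u = c * c + d * d"
    unfolding su by (simp add: u_def algebra_simps mult_scaleC_left mult_scaleC_right assms(3) complex_module.scale_minus_left scaleC_scaleC scaleC_one)
  then have nu: "(norm u)\<^sup>2 = t"
    using norm_star_mult[of u] assms(4,5) by simp
  have "2 *\<^sub>R c = u + star u" unfolding su by (simp add: u_def scaleR_2)
  then have "2 * norm c \<le> norm u + norm (star u)"
    by (metis norm_scaleR abs_numeral norm_triangle_ineq)
  then have "norm c \<le> norm u" by simp
  then show ?thesis using nu power_mono[of "norm c" "norm u" 2] by simp
qed

text \<open>The working form of positivity: unlike b^* b with arbitrary b, a self-adjoint square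
  admits a norm criterion, \<open>sa_square_iff_norm\<close>. That both forms agree in a unital
  algebra is \<open>sa_square_star_mult\<close>.\<close>

definition sa_square :: "'a::cstar_algebra \<Rightarrow> bool" where
  "sa_square a \<longleftrightarrow> (\<exists>c. star c = c \<and> a = c * c)"

lemma sa_square_star: "sa_square a \<Longrightarrow> star a = a"
  by (auto simp: sa_square_def star_mult)

lemma sa_square_scaleR:
  assumes "sa_square a" "r \<ge> 0"
  shows "sa_square (r *\<^sub>R a)"
proof -
  obtain c where "star c = c" "a = c * c" using assms by (auto simp: sa_square_def)
  then have "star (sqrt r *\<^sub>R c) = sqrt r *\<^sub>R c" "r *\<^sub>R a = (sqrt r *\<^sub>R c) * (sqrt r *\<^sub>R c)"
    using assms(2) by (simp_all add: star_scaleR)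
  then show ?thesis unfolding sa_square_def by blast
qed

text \<open>Rescaling by \<open>t\<close> reduces this to \<open>sqrt_one_minus\<close>. The last
  conclusion is the hypothesis again, with \<open>d\<close> and \<open>sqrt t\<close> for
  \<open>a\<close> and \<open>t\<close>, so the root has a root in turn.\<close>

lemma sqrt_of_norm_le:
  fixes a :: "'a::unital_cstar_algebra"
  assumes "star a = a" "norm (of_real t - a) \<le> t"
  obtains d where "star d = d" "d * d = a" "\<And>z. a * z = z * a \<Longrightarrow> d * z = z * d"
    "norm (of_real (sqrt t) - d) \<le> sqrt t"
proof (cases "t = 0")
  case True
  then have "a = 0" using assms by simp
  then show thesis using that[of 0] True by simp
next
  case False
  then have t: "t > 0" using assms(2) norm_ge_zero[of "of_real t - a"] by linarith
  define x where "x = 1 - (1/t) *\<^sub>R a"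
  have "x = (1/t) *\<^sub>R (of_real t - a)"
    using t by (simp add: x_def scaleR_diff_right of_real_def)
  then have "norm x \<le> 1" using assms(2) t by simp
  moreover have "star x = x" by (simp add: x_def star_diff star_scaleR assms)
  ultimately obtain d where d: "star d = d" "d * d = 1 - x" "\<And>z. x * z = z * x \<Longrightarrow> d * z = z * d"
      "norm (1 - d) \<le> 1"
    using sqrt_one_minus by blast
  show thesis
  proof (rule that[of "sqrt t *\<^sub>R d"])
    show "star (sqrt t *\<^sub>R d) = sqrt t *\<^sub>R d" by (simp add: star_scaleR d)
    show "(sqrt t *\<^sub>R d) * (sqrt t *\<^sub>R d) = a" using t by (simp add: d(2) x_def)
    have "of_real (sqrt t) - sqrt t *\<^sub>R d = sqrt t *\<^sub>R (1 - d)"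
      by (simp add: of_real_def scaleR_diff_right)
    then show "norm (of_real (sqrt t) - sqrt t *\<^sub>R d) \<le> sqrt t"
      using t d(4) by (simp add: mult_left_le)
    fix z assume "a * z = z * a"
    then have "x * z = z * x" by (simp add: x_def algebra_simps)
    then show "(sqrt t *\<^sub>R d) * z = z * (sqrt t *\<^sub>R d)" using d(3) by simp
  qed
qed

lemma sa_squareI:
  fixes a :: "'a::unital_cstar_algebra"
  assumes "star a = a" "norm (of_real t - a) \<le> t"
  shows "sa_square a"
proof -
  obtain d where "star d = d" "d * d = a" by (rule sqrt_of_norm_le[OF assms])
  then show ?thesis by (auto simp: sa_square_def)
qed

text \<open>Positivity becomes membership in a ball around a scalar, which is compatible with sums.
  For \<open>a = c * c\<close> the complement \<open>t - a\<close> satisfies the criterion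
  trivially, hence has a root \<open>d\<close> commuting with \<open>c\<close>, and c^2 + d^2 = t
  bounds \<open>d\<close>.\<close>

lemma sa_square_iff_norm:
  fixes a :: "'a::unital_cstar_algebra"
  assumes "star a = a" "norm a \<le> t"
  shows "sa_square a \<longleftrightarrow> norm (of_real t - a) \<le> t"
proof
  assume "norm (of_real t - a) \<le> t"
  with assms(1) show "sa_square a" by (rule sa_squareI)
next
  assume "sa_square a"
  then obtain c where c: "star c = c" "a = c * c" by (auto simp: sa_square_def)
  have nc: "norm (c * c) = (norm c)\<^sup>2" using norm_star_mult[of c] c by simp
  have t0: "t \<ge> 0" using assms(2) norm_ge_zero order_trans by blast
  have "norm (of_real t - (of_real t - c * c)) \<le> t" using assms(2) c by simp
  moreover have "star (of_real t - c * c) = of_real t - c * c"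
    by (simp add: star_diff star_mult c of_real_def star_scaleR)
  ultimately obtain d where d: "star d = d" "d * d = of_real t - c * c"
      "\<And>z. (of_real t - c * c) * z = z * (of_real t - c * c) \<Longrightarrow> d * z = z * d"
    using sqrt_of_norm_le by blast
  have "(of_real t - c * c) * c = c * (of_real t - c * c)" by (simp add: algebra_simps of_real_def)
  then have "d * c = c * d" by (rule d(3))
  then have "(norm d)\<^sup>2 \<le> t"
    using norm_square_le_of_sum_squares[of d c t] c d(1,2) t0 by simp
  then show "norm (of_real t - a) \<le> t"
    using norm_star_mult[of d] d(1,2) c by simp
qed

lemma sa_square_imp_norm_le:
  fixes a :: "'a::unital_cstar_algebra"
  assumes "sa_square a"
  shows "norm (of_real (norm a) - a) \<le> norm a"
  using assms sa_square_iff_norm[OF sa_square_star[OF assms] order_refl] by blast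

text \<open>The triangle inequality adds the ball criteria for radii \<open>norm a\<close> and
  \<open>norm b\<close> to one for \<open>norm a + norm b\<close>.\<close>

lemma sa_square_add:
  fixes a b :: "'a::unital_cstar_algebra"
  assumes "sa_square a" "sa_square b"
  shows "sa_square (a + b)"
proof -
  note st = assms[THEN sa_square_star]
  have "norm (of_real (norm a) - a) \<le> norm a" "norm (of_real (norm b) - b) \<le> norm b"
    by (rule sa_square_imp_norm_le, fact)+
  then have "norm ((of_real (norm a) - a) + (of_real (norm b) - b)) \<le> norm a + norm b"
    using norm_triangle_mono by blast
  then have "norm (of_real (norm a + norm b) - (a + b)) \<le> norm a + norm b"
    by (simp add: algebra_simps)
  moreover have "star (a + b) = a + b" by (simp add: star_add st)
  ultimately show ?thesis
    using sa_square_iff_norm norm_triangle_ineq by blast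
qed

lemma sa_square_norm_minus:
  fixes a :: "'a::unital_cstar_algebra"
  assumes "star a = a"
  shows "sa_square (of_real (norm a) - a)"
proof -
  have "star (of_real (norm a) - a) = of_real (norm a) - a"
    by (simp add: star_diff assms of_real_def star_scaleR)
  moreover have "norm (of_real (norm a) - (of_real (norm a) - a)) \<le> norm a" by simp
  ultimately show ?thesis
    by (rule sa_squareI)
qed

text \<open>With \<open>a = c * c\<close>, the element \<open>norm b - a\<close> is the sum of the
  squares \<open>norm b - b\<close> and \<open>b - a\<close>, hence the square of some
  \<open>d\<close> commuting with \<open>c\<close>. Then c^2 + d^2 is the scalar
  \<open>norm b\<close>.\<close>

lemma norm_mono_sa_square:
  fixes a b :: "'a::unital_cstar_algebra"
  assumes "sa_square a" "sa_square (b - a)"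
  shows "norm a \<le> norm b"
proof -
  obtain c where c: "star c = c" "a = c * c" using assms by (auto simp: sa_square_def)
  define t where "t = norm b"
  have "star b = b" using sa_square_star[OF sa_square_add[OF assms]] by simp
  then have "sa_square ((of_real t - b) + (b - a))"
    using assms sa_square_add sa_square_norm_minus unfolding t_def by blast
  then have s: "sa_square (of_real t - a)" by simp
  define q where "q = of_real t - a"
  have q: "star q = q" "norm (of_real (norm q) - q) \<le> norm q"
    using sa_square_star[OF s] sa_square_imp_norm_le[OF s] unfolding q_def by blast+
  obtain d where d: "star d = d" "d * d = q" "\<And>z. q * z = z * q \<Longrightarrow> d * z = z * d"
    using sqrt_of_norm_le[OF q] by blast
  have "q * c = c * q" by (simp add: q_def c algebra_simps of_real_def)
  then have "d * c = c * d" by (rule d(3))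
  then have "(norm c)\<^sup>2 \<le> t"
    using norm_square_le_of_sum_squares[of c d t] c d(1,2) by (simp add: q_def t_def)
  then show ?thesis using norm_star_mult[of c] c by (simp add: t_def)
qed

section \<open>Elements b^* b are squares of self-adjoint elements\<close>

lemma power_le_linear_imp_le_one:
  fixes x :: real
  assumes "x \<ge> 0" "\<And>k. x ^ (2 ^ k) \<le> 1 + 2 ^ k"
  shows "x \<le> 1"
proof (rule ccontr)
  assume "\<not> x \<le> 1"
  then have x: "x > 1" by simp
  have "(\<lambda>n. inverse (x ^ n) + real n / x ^ n) \<longlonglongrightarrow> 0 + 0"
    using x by (intro tendsto_add LIMSEQ_inverse_realpow_zero lim_n_over_pown) auto
  then have "(\<lambda>n. (1 + real n) / x ^ n) \<longlonglongrightarrow> 0"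
    by (simp add: add_divide_distrib inverse_eq_divide)
  moreover have "filterlim (\<lambda>k. 2 ^ k :: nat) sequentially sequentially"
    by (rule filterlim_subseq) (simp add: strict_mono_def)
  ultimately have "(\<lambda>k. (1 + real (2 ^ k)) / x ^ (2 ^ k)) \<longlonglongrightarrow> 0"
    by (rule filterlim_compose)
  then have "eventually (\<lambda>k. (1 + real (2 ^ k)) / x ^ (2 ^ k) < 1) sequentially"
    by (rule order_tendstoD) simp
  then obtain k where "(1 + real (2 ^ k)) / x ^ (2 ^ k) < 1"
    using eventually_sequentially by auto
  with assms(2)[of k] show False using \<open>\<not> x \<le> 1\<close> by (simp add: field_simps)
qed

text \<open>Since \<open>c\<^sup>* c + c c\<^sup>*\<close> is a sum of squares, the hypothesis makes \<open>c c\<^sup>*\<close> positive. The powers of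
  \<open>1 - s c\<^sup>* c = 1 + s p\<close> are expressed by those of the contraction \<open>1 - s c c\<^sup>*\<close> and grow
  at most linearly, so \<open>1 + s p\<close> is a contraction as well.\<close>

lemma sa_square_minus_star_mult:
  fixes c p :: "'a::unital_cstar_algebra"
  assumes p: "sa_square p" and c: "star c * c = - p"
  shows "p = 0"
proof (cases "c = 0")
  case True
  then show ?thesis using c by simp
next
  case False
  define s where "s = 1 / (norm c)\<^sup>2"
  have s: "s > 0" using False by (simp add: s_def)
  define q where "q = c * star c"
  define u v where "u = c + star c" and "v = \<i> *\<^sub>C (c - star c)"
  have uv: "star u = u" "star v = v"
    by (simp_all add: u_def v_def star_add star_star star_scaleC star_diff complex_module.scale_minus_left
        complex_module.scale_right_diff_distrib)
  have "u * u + v * v = 2 *\<^sub>R (star c * c + c * star c)"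
    by (simp add: u_def v_def mult_scaleC_left mult_scaleC_right scaleC_scaleC scaleR_2
        complex_module.scale_minus_left scaleC_one algebra_simps)
  then have q_eq: "q = (1/2) *\<^sub>R (u * u + v * v) + p"
    unfolding c q_def by simp
  have "sa_square (u * u)" "sa_square (v * v)" using uv unfolding sa_square_def by blast+
  then have "sa_square q" unfolding q_eq
    by (intro sa_square_add sa_square_scaleR p) auto
  moreover have "norm q = (norm c)\<^sup>2"
    using norm_star_mult[of "star c"] by (simp add: q_def star_star)
  ultimately have "norm (of_real ((norm c)\<^sup>2) - q) \<le> (norm c)\<^sup>2"
    using sa_square_iff_norm[of q "(norm c)\<^sup>2"] sa_square_star by force
  moreover have "1 - s *\<^sub>R q = s *\<^sub>R (of_real ((norm c)\<^sup>2) - q)"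
    using False by (simp add: s_def of_real_def scaleR_diff_right)
  ultimately have "norm (1 - s *\<^sub>R q) \<le> s * (norm c)\<^sup>2"
    using s by (metis abs_of_pos mult_left_mono norm_scaleR order_less_imp_le)
  also have "s * (norm c)\<^sup>2 = 1" using False by (simp add: s_def)
  finally have q1: "norm (1 - s *\<^sub>R q) \<le> 1" .
  define w where "w = 1 + s *\<^sub>R p"
  have w_eq: "w = 1 - s *\<^sub>R (star c * c)" by (simp add: w_def c)
  have cw: "c * w = (1 - s *\<^sub>R q) * c"
    by (simp add: w_eq q_def right_diff_distrib left_diff_distrib mult.assoc)
  have cwn: "c * w ^ n = (1 - s *\<^sub>R q) ^ n * c" for n
  proof (induction n)
    case (Suc n)
    have "c * w ^ Suc n = (1 - s *\<^sub>R q) * (c * w ^ n)"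
      unfolding power_Suc using cw by (metis mult.assoc)
    then show ?case unfolding Suc power_Suc by (simp only: mult.assoc)
  qed simp
  have nwn: "norm (w ^ n) \<le> 1 + n" for n
  proof (induction n)
    case (Suc n)
    have "w ^ Suc n = w ^ n - s *\<^sub>R (star c * (c * w ^ n))"
      unfolding power_Suc by (subst (1) w_eq) (simp add: left_diff_distrib mult.assoc)
    also have "c * w ^ n = (1 - s *\<^sub>R q) ^ n * c" by (rule cwn)
    finally have "norm (w ^ Suc n) \<le> norm (w ^ n) + s * norm (star c * ((1 - s *\<^sub>R q) ^ n * c))"
      using s norm_triangle_ineq4 by (metis abs_of_pos norm_scaleR)
    also have "norm (star c * ((1 - s *\<^sub>R q) ^ n * c)) \<le> norm c * (1 * norm c)"
    proof -
      have "norm ((1 - s *\<^sub>R q) ^ n) \<le> 1"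
        using norm_power_ineq[of "1 - s *\<^sub>R q" n] power_le_one[OF norm_ge_zero q1, of n] by linarith
      then have "norm ((1 - s *\<^sub>R q) ^ n * c) \<le> 1 * norm c"
        using norm_mult_ineq order_trans mult_right_mono norm_ge_zero by meson
      then have "norm (star c) * norm ((1 - s *\<^sub>R q) ^ n * c) \<le> norm c * (1 * norm c)"
        by (intro mult_mono) auto
      then show ?thesis using norm_mult_ineq order_trans by blast
    qed
    also have "s * (norm c * (1 * norm c)) = 1" using False by (simp add: s_def power2_eq_square)
    finally show ?case using Suc s by simp
  qed simp
  have sw: "star w = w" using sa_square_star[OF p] by (simp add: w_def star_add star_scaleR)
  \<comment> \<open>Linear growth of the powers excludes \<open>norm w > 1\<close>, because
    \<open>norm_power_two_power\<close> makes the norm multiplicative along the exponents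
    2^k.\<close>
  have "norm w \<le> 1"
    by (rule power_le_linear_imp_le_one) (use nwn[of "2 ^ _"] norm_power_two_power[OF sw] in auto)
  \<comment> \<open>This is the ball criterion for - s p with radius 1. So s p and - s p are both
    positive, and monotonicity of the norm between s p and 0 forces p = 0.\<close>
  then have "norm (of_real 1 - (- (s *\<^sub>R p))) \<le> 1" by (simp add: w_def)
  then have "sa_square (- (s *\<^sub>R p))"
    by (rule sa_squareI[rotated]) (simp add: star_minus star_scaleR sa_square_star[OF p])
  then have "norm (s *\<^sub>R p) \<le> norm (0 :: 'a)"
    by (intro norm_mono_sa_square sa_square_scaleR p) (use s in auto)
  then show ?thesis using s by (simp add: mult_le_0_iff)
qed

text \<open>Kaplansky's argument: with \<open>a = b\<^sup>* b\<close> and \<open>r = \<bar>a\<bar>\<close>, the element \<open>c = b (r - a)\<close>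
  satisfies \<open>c\<^sup>* c = - r (r - a)\<^sup>2\<close>.\<close>

lemma sa_square_star_mult:
  fixes b :: "'a::unital_cstar_algebra"
  shows "sa_square (star b * b)"
proof -
  define a where "a = star b * b"
  have a: "star a = a" by (simp add: a_def star_mult star_star)
  have aa: "sa_square (a * a)" "star (a * a) = a * a"
    using a sa_square_def by (blast, simp add: star_mult)
  then have "norm (of_real (norm (a * a)) - a * a) \<le> norm (a * a)"
    using sa_square_imp_norm_le by blast
  with aa obtain r where r: "star r = r" "r * r = a * a"
      "\<And>z. a * a * z = z * (a * a) \<Longrightarrow> r * z = z * r"
      "norm (of_real (sqrt (norm (a * a))) - r) \<le> sqrt (norm (a * a))"
    using sqrt_of_norm_le by blast
  \<comment> \<open>A root of \<open>r\<close> exhibits r (r - a)^2 as the square of the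
    self-adjoint element m (r - a).\<close>
  obtain m where m: "star m = m" "m * m = r" "\<And>z. r * z = z * r \<Longrightarrow> m * z = z * m"
    using sqrt_of_norm_le[OF r(1,4)] by blast
  have ra: "r * a = a * r" by (rule r(3)) (simp add: mult.assoc)
  then have ma: "m * a = a * m" by (rule m(3))
  have mr: "m * r = r * m" by (rule m(3)) simp
  have mra: "m * (r - a) = (r - a) * m"
    by (simp only: left_diff_distrib right_diff_distrib ma mr)
  define e where "e = m * (r - a)"
  have e: "star e = e"
    by (simp add: e_def star_mult star_diff a r(1) m(1) mra)
  have "star (b * (r - a)) * (b * (r - a)) = (r - a) * (star b * b) * (r - a)"
    by (simp add: star_mult star_diff a r(1) mult.assoc)
  also have "(r - a) * (star b * b) = - (r * (r - a))"
    unfolding a_def[symmetric] by (simp add: left_diff_distrib right_diff_distrib r(2))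
  also have "- (r * (r - a)) * (r - a) = - (e * e)"
  proof -
    have "e * e = m * (m * (r - a)) * (r - a)"
      unfolding e_def using mra by (metis mult.assoc)
    also have "m * (m * (r - a)) = r * (r - a)"
      unfolding m(2)[symmetric] by (simp only: mult.assoc)
    finally show ?thesis by simp
  qed
  finally have "e * e = 0"
    by (intro sa_square_minus_star_mult) (use e in \<open>unfold sa_square_def, blast+\<close>)
  then have "e = 0" using norm_star_mult[of e] e by simp
  then have "r * (r - a) = 0" unfolding e_def by (metis m(2) mult.assoc mult_zero_right)
  then have ra': "r * a = a * a" by (simp add: right_diff_distrib r(2))
  \<comment> \<open>Since r^2 = a^2 and r a = a r = a^2, all terms of (r - a)^2 cancel.\<close>
  have "star (r - a) * (r - a) = 0"
    by (simp add: star_diff a r(1)) (simp add: left_diff_distrib right_diff_distrib r(2) ra' ra[symmetric])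
  then have "r = a" using norm_star_mult[of "r - a"] by simp
  then have "a = m * m" using m(2) by simp
  then show ?thesis unfolding sa_square_def a_def[symmetric] using m(1) by blast
qed

section \<open>The unitization of a C*-algebra\<close>

datatype 'a unitization = Unitization (alg_part: 'a) (scal_part: complex)

lemma unitization_eq_iff: "u = v \<longleftrightarrow> alg_part u = alg_part v \<and> scal_part u = scal_part v"
  by (auto intro: unitization.expand)

text \<open>The unitization acts by left multiplication on its ideal \<open>'a\<close>; the operator
  norm of this action enters the norm of the unitization.\<close>

definition lmult :: "'a::cstar_algebra unitization \<Rightarrow> 'a \<Rightarrow> 'a" where
  "lmult u c = alg_part u * c + scal_part u *\<^sub>C c"

instantiation unitization :: (cstar_algebra) complex_vector
begin

definition "0 = Unitization 0 0"
definition "u + v = Unitization (alg_part u + alg_part v) (scal_part u + scal_part v)"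
definition "- u = Unitization (- alg_part u) (- scal_part u)"
definition "u - v = Unitization (alg_part u - alg_part v) (scal_part u - scal_part v)"
definition "r *\<^sub>R u = Unitization (r *\<^sub>R alg_part u) (r *\<^sub>R scal_part u)"
definition "c *\<^sub>C u = Unitization (c *\<^sub>C alg_part u) (c * scal_part u)"

instance
  by standard
    (simp_all add: unitization_eq_iff zero_unitization_def plus_unitization_def
      uminus_unitization_def minus_unitization_def scaleR_unitization_def scaleC_unitization_def
      scaleR_scaleC scaleC_add_right scaleC_add_left scaleC_scaleC scaleC_one algebra_simps
      scaleR_conv_of_real)

end

instantiation unitization :: (cstar_algebra) ring_1
begin

definition "1 = Unitization 0 1"
definition "u * v = Unitization
  (alg_part u * alg_part v + scal_part v *\<^sub>C alg_part u + scal_part u *\<^sub>C alg_part v)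
  (scal_part u * scal_part v)"

instance
  by standard
    (simp_all add: unitization_eq_iff zero_unitization_def plus_unitization_def
      uminus_unitization_def minus_unitization_def one_unitization_def times_unitization_def
      scaleC_add_right scaleC_add_left scaleC_scaleC scaleC_one algebra_simps
      mult_scaleC_left mult_scaleC_right)

end

lemmas unitization_defs = zero_unitization_def plus_unitization_def uminus_unitization_def
  minus_unitization_def scaleR_unitization_def scaleC_unitization_def one_unitization_def
  times_unitization_def

lemma lmult_mult: "lmult (u * v) c = lmult u (lmult v c)"
  by (simp add: lmult_def unitization_defs algebra_simps mult_scaleC_left mult_scaleC_right
      scaleC_add_right scaleC_scaleC)

lemma lmult_add: "lmult (u + v) c = lmult u c + lmult v c"
  by (simp add: lmult_def unitization_defs algebra_simps scaleC_add_left)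

lemma lmult_scaleC: "lmult (z *\<^sub>C u) c = z *\<^sub>C lmult u c"
  by (simp add: lmult_def unitization_defs mult_scaleC_left scaleC_add_right scaleC_scaleC)

lemma lmult_one: "lmult 1 c = c"
  by (simp add: lmult_def unitization_defs scaleC_one)

lemma bounded_linear_lmult: "bounded_linear (lmult u)"
proof (rule bounded_linear_intro)
  show "lmult u (x + y) = lmult u x + lmult u y" for x y
    by (simp add: lmult_def scaleC_add_right algebra_simps)
  show "lmult u (r *\<^sub>R x) = r *\<^sub>R lmult u x" for r x
    by (simp add: lmult_def scaleC_scaleR_commute algebra_simps)
  show "norm (lmult u x) \<le> norm x * (norm (alg_part u) + cmod (scal_part u))" for x
  proof -
    have "norm (lmult u x) \<le> norm (alg_part u * x) + norm (scal_part u *\<^sub>C x)"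
      unfolding lmult_def by (rule norm_triangle_ineq)
    then show ?thesis
      using norm_mult_ineq[of "alg_part u" x] by (simp add: norm_scaleC algebra_simps)
  qed
qed

lemma norm_lmult_le_onorm: "norm (lmult u c) \<le> onorm (lmult u) * norm c"
  by (rule onorm[OF bounded_linear_lmult])

lemma onorm_lmult_nonneg: "0 \<le> onorm (lmult u)"
  by (rule onorm_pos_le[OF bounded_linear_lmult])

text \<open>If \<open>A\<close> already has a unit, then \<open>onorm (lmult u)\<close> alone is only a seminorm; the maximum
  with the norm of the character \<open>scal_part\<close> is a C*-norm in all cases.\<close>

instantiation unitization :: (cstar_algebra) real_normed_algebra_1
begin

definition "norm u = max (cmod (scal_part u)) (onorm (lmult u))"
definition "dist u v = norm (u - v)" for u v :: "'a unitization"
definition "sgn u = inverse (norm u) *\<^sub>R u" for u :: "'a unitization"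
definition uniformity_unitization :: "('a unitization \<times> 'a unitization) filter" where
  "uniformity_unitization = (INF e\<in>{0<..}. principal {(x, y). dist x y < e})"
definition open_unitization :: "'a unitization set \<Rightarrow> bool" where
  "open_unitization U \<longleftrightarrow> (\<forall>x\<in>U. eventually (\<lambda>(x', y). x' = x \<longrightarrow> y \<in> U) uniformity)"

instance
proof
  fix u v :: "'a unitization" and r :: real
  show "dist u v = norm (u - v)" by (rule dist_unitization_def)
  show "sgn u = inverse (norm u) *\<^sub>R u" by (rule sgn_unitization_def)
  show "(uniformity :: ('a unitization \<times> 'a unitization) filter)
      = (INF e\<in>{0<..}. principal {(x, y). dist x y < e})"
    by (rule uniformity_unitization_def)
  show "open U \<longleftrightarrow> (\<forall>x\<in>U. eventually (\<lambda>(x', y). x' = x \<longrightarrow> y \<in> U) uniformity)"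
    for U :: "'a unitization set" by (rule open_unitization_def)
  show "r *\<^sub>R u * v = r *\<^sub>R (u * v)" "u * r *\<^sub>R v = r *\<^sub>R (u * v)"
    by (simp_all add: unitization_eq_iff unitization_defs scaleR_scaleC mult_scaleC_left
        mult_scaleC_right scaleC_add_right scaleC_scaleC scaleR_conv_of_real mult_ac)
  show "norm u = 0 \<longleftrightarrow> u = 0"
  proof
    assume n: "norm u = 0"
    then have "scal_part u = 0" "onorm (lmult u) = 0"
      using onorm_lmult_nonneg[of u] norm_ge_zero[of "scal_part u"]
      unfolding norm_unitization_def by (smt (verit) norm_eq_zero)+
    then have "lmult u c = 0" for c
      using onorm_eq_0[OF bounded_linear_lmult] by metis
    then have "alg_part u * star (alg_part u) = 0"
      using \<open>scal_part u = 0\<close> unfolding lmult_def by simp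
    then have "alg_part u = 0"
      using norm_star_mult[of "star (alg_part u)"] by (simp add: star_star)
    with \<open>scal_part u = 0\<close> show "u = 0" by (simp add: unitization_eq_iff unitization_defs)
  next
    assume "u = 0"
    then have "lmult u = (\<lambda>c. 0)" by (auto simp: lmult_def unitization_defs)
    with \<open>u = 0\<close> show "norm u = 0"
      by (simp add: norm_unitization_def onorm_zero zero_unitization_def)
  qed
  show "norm (u + v) \<le> norm u + norm v"
  proof -
    have "lmult (u + v) = (\<lambda>c. lmult u c + lmult v c)" by (rule ext) (rule lmult_add)
    then have "onorm (lmult (u + v)) \<le> onorm (lmult u) + onorm (lmult v)"
      using onorm_triangle[OF bounded_linear_lmult bounded_linear_lmult] by metis
    moreover have "cmod (scal_part (u + v)) \<le> cmod (scal_part u) + cmod (scal_part v)"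
      by (simp add: unitization_defs norm_triangle_ineq)
    ultimately show ?thesis unfolding norm_unitization_def by linarith
  qed
  show "norm (r *\<^sub>R u) = \<bar>r\<bar> * norm u"
  proof -
    have "lmult (r *\<^sub>R u) = (\<lambda>c. r *\<^sub>R lmult u c)"
      by (rule ext) (simp add: scaleR_scaleC lmult_scaleC)
    then have "onorm (lmult (r *\<^sub>R u)) = \<bar>r\<bar> * onorm (lmult u)"
      using onorm_scaleR[OF bounded_linear_lmult] by metis
    then show ?thesis
      by (simp add: norm_unitization_def unitization_defs max_mult_distrib_left norm_mult)
  qed
  show "norm (u * v) \<le> norm u * norm v"
  proof -
    have "lmult (u * v) = lmult u \<circ> lmult v" by (rule ext) (simp add: lmult_mult)
    then have "onorm (lmult (u * v)) \<le> onorm (lmult u) * onorm (lmult v)"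
      using onorm_compose[OF bounded_linear_lmult bounded_linear_lmult] by metis
    also have "\<dots> \<le> norm u * norm v"
      by (intro mult_mono) (auto simp: norm_unitization_def onorm_lmult_nonneg le_max_iff_disj)
    finally have "onorm (lmult (u * v)) \<le> norm u * norm v" .
    moreover have "cmod (scal_part (u * v)) \<le> norm u * norm v"
      by (simp add: unitization_defs norm_mult)
        (intro mult_mono, auto simp: norm_unitization_def le_max_iff_disj)
    ultimately show ?thesis by (simp add: norm_unitization_def[of "u * v"])
  qed
  show "norm (1 :: 'a unitization) = 1"
  proof -
    have "onorm (lmult (1 :: 'a unitization)) \<le> 1"
      by (rule onorm_bound) (simp_all add: lmult_one)
    then show ?thesis by (simp add: norm_unitization_def one_unitization_def max_def)
  qed
qed

end

section \<open>Completeness of the unitization\<close>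

lemma norm_unitization_le: "norm u \<le> norm (alg_part u) + cmod (scal_part u)"
proof -
  have "onorm (lmult u) \<le> norm (alg_part u) + cmod (scal_part u)"
  proof (rule onorm_bound)
    fix c
    have "norm (lmult u c) \<le> norm (alg_part u * c) + norm (scal_part u *\<^sub>C c)"
      unfolding lmult_def by (rule norm_triangle_ineq)
    then show "norm (lmult u c) \<le> (norm (alg_part u) + cmod (scal_part u)) * norm c"
      using norm_mult_ineq[of "alg_part u" c] by (simp add: norm_scaleC algebra_simps)
  qed simp
  then show ?thesis by (simp add: norm_unitization_def)
qed

lemma norm_scal_part_le: "cmod (scal_part u) \<le> norm u"
  by (simp add: norm_unitization_def)

text \<open>Testing the operator on \<open>star a\<close>, for \<open>a = alg_part u\<close>,
  recovers norm a squared by the C*-identity. The bound serves completeness and, for scalar part 0,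
  shows that \<open>unitize\<close> is isometric.\<close>

lemma norm_alg_part_le_onorm: "norm (alg_part u) \<le> onorm (lmult u) + cmod (scal_part u)"
proof (cases "alg_part u = 0")
  case True
  then show ?thesis using onorm_lmult_nonneg[of u] by simp
next
  case False
  define a where "a = alg_part u"
  have "norm a * norm a = norm (a * star a)"
    using norm_star_mult[of "star a"] by (simp add: star_star power2_eq_square)
  also have "a * star a = lmult u (star a) - scal_part u *\<^sub>C star a"
    by (simp add: lmult_def a_def)
  also have "norm \<dots> \<le> norm (lmult u (star a)) + norm (scal_part u *\<^sub>C star a)"
    by (rule norm_triangle_ineq4)
  also have "\<dots> \<le> (onorm (lmult u) + cmod (scal_part u)) * norm a"
    using norm_lmult_le_onorm[of u "star a"] by (simp add: norm_scaleC algebra_simps)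
  finally show ?thesis using False by (simp add: a_def)
qed

text \<open>The norm is equivalent to the sum of the norms of the two components, so Cauchy
  sequences can be treated componentwise.\<close>

instance unitization :: (cstar_algebra) banach
proof
  fix X :: "nat \<Rightarrow> 'a unitization"
  assume X: "Cauchy X"
  have diff: "alg_part (u - v) = alg_part u - alg_part v" "scal_part (u - v) = scal_part u - scal_part v"
    for u v :: "'a unitization"
    by (simp_all add: unitization_defs)
  have le: "norm (alg_part u) \<le> 2 * norm u" for u :: "'a unitization"
    using norm_alg_part_le_onorm[of u] norm_scal_part_le[of u] by (simp add: norm_unitization_def)
  have "Cauchy (\<lambda>n. alg_part (X n))"
  proof (rule CauchyI)
    fix e :: real assume "e > 0"
    then obtain N where N: "\<And>m n. m \<ge> N \<Longrightarrow> n \<ge> N \<Longrightarrow> norm (X m - X n) < e / 2"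
      using CauchyD[OF X, of "e / 2"] by auto
    show "\<exists>M. \<forall>m\<ge>M. \<forall>n\<ge>M. norm (alg_part (X m) - alg_part (X n)) < e"
    proof (intro exI allI impI)
      fix m n assume "N \<le> m" "N \<le> n"
      then show "norm (alg_part (X m) - alg_part (X n)) < e"
        using N[of m n] le[of "X m - X n"] by (simp add: diff)
    qed
  qed
  then obtain a where a: "(\<lambda>n. alg_part (X n)) \<longlonglongrightarrow> a"
    using Cauchy_convergent convergent_def by blast
  have "Cauchy (\<lambda>n. scal_part (X n))"
  proof (rule CauchyI)
    fix e :: real assume "e > 0"
    then obtain N where N: "\<And>m n. m \<ge> N \<Longrightarrow> n \<ge> N \<Longrightarrow> norm (X m - X n) < e"
      using CauchyD[OF X, of e] by auto
    show "\<exists>M. \<forall>m\<ge>M. \<forall>n\<ge>M. norm (scal_part (X m) - scal_part (X n)) < e"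
    proof (intro exI allI impI)
      fix m n assume "N \<le> m" "N \<le> n"
      then show "norm (scal_part (X m) - scal_part (X n)) < e"
        using N[of m n] norm_scal_part_le[of "X m - X n"] by (simp add: diff)
    qed
  qed
  then obtain l where l: "(\<lambda>n. scal_part (X n)) \<longlonglongrightarrow> l"
    using Cauchy_convergent convergent_def by blast
  have "(\<lambda>n. norm (alg_part (X n) - a) + cmod (scal_part (X n) - l)) \<longlonglongrightarrow> 0 + 0"
    by (intro tendsto_add tendsto_norm_zero LIM_zero a l)
  then have "(\<lambda>n. norm (alg_part (X n) - a) + cmod (scal_part (X n) - l)) \<longlonglongrightarrow> 0" by simp
  then have "(\<lambda>n. X n - Unitization a l) \<longlonglongrightarrow> 0"
  proof (rule Lim_null_comparison[rotated], intro always_eventually allI)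
    show "norm (X n - Unitization a l) \<le> norm (alg_part (X n) - a) + cmod (scal_part (X n) - l)" for n
      using norm_unitization_le[of "X n - Unitization a l"] by (simp add: diff)
  qed
  then show "convergent X" using LIM_zero_cancel convergent_def by blast
qed

section \<open>The C*-identity in the unitization\<close>

instantiation unitization :: (cstar_algebra) unital_cstar_algebra
begin

definition "star u = Unitization (star (alg_part u)) (cnj (scal_part u))"

text \<open>For the algebra-valued inner product \<open>star c * d\<close> on \<open>'a\<close>, the
  operator \<open>lmult (star u)\<close> is adjoint to \<open>lmult u\<close>.\<close>

lemma star_lmult_mult: "star (lmult u c) * d = star c * lmult (star u) d"
  by (simp add: lmult_def star_unitization_def star_add star_mult star_scaleC algebra_simps
      mult_scaleC_left mult_scaleC_right)

text \<open>The usual argument for adjoint pairs: the norm of u c squared is that of c^* (u^* u c),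
  whence the square of the norm of u is at most that of u^* u, which is at most the product of the
  norms of u^* and u. Cancelling gives equal norms for u and u^*.\<close>

lemma onorm_lmult_star_mult: "onorm (lmult (star u * u)) = (onorm (lmult u))\<^sup>2"
proof -
  have compose: "onorm (lmult (star w * w)) \<le> onorm (lmult (star w)) * onorm (lmult w)"
    for w :: "'a unitization"
  proof -
    have "lmult (star w * w) = lmult (star w) \<circ> lmult w" by (rule ext) (simp add: lmult_mult)
    then show ?thesis using onorm_compose[OF bounded_linear_lmult bounded_linear_lmult] by metis
  qed
  have square: "(onorm (lmult w))\<^sup>2 \<le> onorm (lmult (star w * w))" for w :: "'a unitization"
  proof -
    define M where "M = onorm (lmult (star w * w))"
    have "norm (lmult w c) \<le> sqrt M * norm c" for c
    proof -
      have "(norm (lmult w c))\<^sup>2 = norm (star c * lmult (star w * w) c)"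
        by (simp add: lmult_mult star_lmult_mult flip: norm_star_mult)
      also have "\<dots> \<le> norm c * (M * norm c)"
        using norm_mult_ineq[of "star c" "lmult (star w * w) c"] norm_lmult_le_onorm[of "star w * w" c]
        by (simp add: M_def) (meson mult_left_mono norm_ge_zero order_trans)
      also have "\<dots> = (sqrt M * norm c)\<^sup>2"
        using onorm_lmult_nonneg[of "star w * w"] by (simp add: M_def power2_eq_square)
      finally show ?thesis
        by (rule power2_le_imp_le) (simp add: M_def onorm_lmult_nonneg)
    qed
    then have "onorm (lmult w) \<le> sqrt M"
      by (intro onorm_bound) (simp_all add: M_def onorm_lmult_nonneg)
    then have "(onorm (lmult w))\<^sup>2 \<le> (sqrt M)\<^sup>2"
      by (rule power_mono) (rule onorm_lmult_nonneg)
    then show ?thesis by (simp add: M_def onorm_lmult_nonneg)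
  qed
  have le: "onorm (lmult w) \<le> onorm (lmult (star w))" for w :: "'a unitization"
  proof (cases "onorm (lmult w) = 0")
    case False
    then have "onorm (lmult w) > 0" using onorm_lmult_nonneg[of w] by linarith
    moreover have "onorm (lmult w) * onorm (lmult w) \<le> onorm (lmult (star w)) * onorm (lmult w)"
      using square[of w] compose[of w] by (simp add: power2_eq_square)
    ultimately show ?thesis by simp
  qed (simp add: onorm_lmult_nonneg)
  have "star (star u) = u" by (simp add: star_unitization_def unitization_eq_iff star_star)
  then have "onorm (lmult (star u)) = onorm (lmult u)" using le[of u] le[of "star u"] by simp
  then show ?thesis using compose[of u] square[of u] by (simp add: power2_eq_square)
qed

instance
proof
  fix u v :: "'a unitization" and c :: complex
  show "norm (c *\<^sub>C u) = cmod c * norm u"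
  proof -
    have "onorm (lmult (z *\<^sub>C w)) \<le> cmod z * onorm (lmult w)" for z and w :: "'a unitization"
    proof (rule onorm_bound)
      fix d show "norm (lmult (z *\<^sub>C w) d) \<le> cmod z * onorm (lmult w) * norm d"
        using mult_left_mono[OF norm_lmult_le_onorm[of w d], of "cmod z"]
        by (simp add: lmult_scaleC norm_scaleC mult.assoc)
    qed (simp add: onorm_lmult_nonneg)
    note le = this
    have "onorm (lmult (c *\<^sub>C u)) = cmod c * onorm (lmult u)"
    proof (cases "c = 0")
      case True
      then show ?thesis using le[of c u] onorm_lmult_nonneg[of "c *\<^sub>C u"] by simp
    next
      case False
      have "onorm (lmult (inverse c *\<^sub>C (c *\<^sub>C u))) \<le> cmod (inverse c) * onorm (lmult (c *\<^sub>C u))"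
        by (rule le)
      then have "cmod c * onorm (lmult u) \<le> onorm (lmult (c *\<^sub>C u))"
        using False by (simp add: scaleC_scaleC scaleC_one norm_divide field_simps)
      then show ?thesis using le[of c u] by simp
    qed
    then show ?thesis
      by (simp add: norm_unitization_def scaleC_unitization_def max_mult_distrib_left norm_mult)
  qed
  show "norm (star u * u) = (norm u)\<^sup>2"
  proof -
    have "cmod (scal_part (star u * u)) = (cmod (scal_part u))\<^sup>2"
      by (simp add: star_unitization_def times_unitization_def norm_mult power2_eq_square)
    then show ?thesis
      by (simp add: norm_unitization_def onorm_lmult_star_mult max_def onorm_lmult_nonneg power_mono_iff)
  qed
qed (simp_all add: unitization_eq_iff star_unitization_def unitization_defs star_add star_mult
      star_scaleC star_star mult_scaleC_left mult_scaleC_right scaleC_add_right scaleC_scaleC algebra_simps)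

end

definition unitize :: "'a::cstar_algebra \<Rightarrow> 'a unitization" where
  "unitize a = Unitization a 0"

lemma unitize_simps:
  "unitize (a + b) = unitize a + unitize b"
  "unitize (a - b) = unitize a - unitize b"
  "unitize (a * b) = unitize a * unitize b"
  "unitize (star a) = star (unitize a)"
  "unitize (r *\<^sub>R a) = r *\<^sub>R unitize a"
  by (simp_all add: unitize_def unitization_defs star_unitization_def unitization_eq_iff)

lemma norm_unitize [simp]: "norm (unitize a) = norm a"
  using norm_unitization_le[of "unitize a"] norm_alg_part_le_onorm[of "unitize a"]
  by (simp add: unitize_def norm_unitization_def onorm_lmult_nonneg)

section \<open>The order of a C*-algebra\<close>

text \<open>Positivity is tested in the unitization, where the results on squares apply;
  \<open>cpos_if_cstar_positive\<close> carries over the positivity of inner products.\<close>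

definition cpos :: "'a::cstar_algebra \<Rightarrow> bool" where
  "cpos a \<longleftrightarrow> sa_square (unitize a)"

lemma cpos_star_mult: "cpos (star b * b)"
  unfolding cpos_def unitize_simps by (rule sa_square_star_mult)

lemma cpos_if_cstar_positive: "cstar_positive a \<Longrightarrow> cpos a"
  by (auto simp: cstar_positive_def cpos_star_mult)

lemma cpos_zero [simp]: "cpos 0"
  using cpos_star_mult[of 0] by simp

lemma cpos_add: "cpos a \<Longrightarrow> cpos b \<Longrightarrow> cpos (a + b)"
  unfolding cpos_def unitize_simps by (rule sa_square_add)

lemma cpos_sum: "(\<And>i. i \<in> I \<Longrightarrow> cpos (f i)) \<Longrightarrow> cpos (sum f I)"
  by (induction I rule: infinite_finite_induct) (auto intro: cpos_add)

lemma cpos_scaleR: "cpos a \<Longrightarrow> r \<ge> 0 \<Longrightarrow> cpos (r *\<^sub>R a)"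
  unfolding cpos_def unitize_simps by (rule sa_square_scaleR)

lemma norm_mono_cpos: "cpos a \<Longrightarrow> cpos (b - a) \<Longrightarrow> norm a \<le> norm b"
  using norm_mono_sa_square[of "unitize a" "unitize b"] by (simp add: cpos_def unitize_simps)

text \<open>In the unitization \<open>norm a - a\<close> is a square d d with \<open>d\<close>
  self-adjoint, and conjugation by \<open>z\<close> turns it into (d z)^* (d z).\<close>

lemma cpos_norm_conj:
  assumes "star a = a"
  shows "cpos (norm a *\<^sub>R (star z * z) - star z * a * z)"
proof -
  have "star (unitize a) = unitize a" using assms by (metis unitize_simps(4))
  then obtain d where d: "star d = d" "of_real (norm a) - unitize a = d * d"
    using sa_square_norm_minus[of "unitize a"] by (auto simp: sa_square_def)
  have "star (d * unitize z) * (d * unitize z) = star (unitize z) * (d * d) * unitize z"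
    by (simp add: star_mult d(1) mult.assoc)
  also have "\<dots> = unitize (norm a *\<^sub>R (star z * z) - star z * a * z)"
    unfolding d(2)[symmetric]
    by (simp add: unitize_simps left_diff_distrib right_diff_distrib mult.assoc of_real_def)
  finally show ?thesis unfolding cpos_def by (metis sa_square_star_mult)
qed

section \<open>Hilbert modules\<close>

context hilbert_module
begin

lemma act_zero_left [simp]: "act 0 a = 0"
  using act_add_left[of 0 0 a] by simp

lemma act_minus_left: "act (- x) a = - act x a"
  using act_add_left[of x "- x" a] by (simp add: eq_neg_iff_add_eq_0 add.commute)

lemma act_diff_left: "act (x - y) a = act x a - act y a"
  using act_add_left[of x "- y" a] by (simp add: act_minus_left)

lemma act_scaleR_left: "act (r *\<^sub>R x) a = r *\<^sub>R act x a"
  by (simp add: scaleR_scaleC act_scaleC_left)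

lemma act_sum_left: "act (sum f I) a = (\<Sum>i\<in>I. act (f i) a)"
  by (induction I rule: infinite_finite_induct) (simp_all add: act_add_left)

lemma ip_add_left: "ip (x + y) z = ip x z + ip y z"
  using star_ip ip_add_right star_add by metis

lemma ip_act_left: "ip (act x a) y = star a * ip x y"
  using star_ip ip_act_right star_mult by metis

lemma ip_scaleR_right: "ip x (r *\<^sub>R y) = r *\<^sub>R ip x y"
  by (simp add: scaleR_scaleC ip_scaleC_right)

lemma ip_scaleR_left: "ip (r *\<^sub>R x) y = r *\<^sub>R ip x y"
  using star_ip ip_scaleR_right star_scaleR by metis

lemma ip_zero [simp]: "ip 0 y = 0" "ip y 0 = 0"
  using ip_add_left[of 0 0 y] ip_add_right[of y 0 0] by simp_all

lemma ip_minus_left: "ip (- x) y = - ip x y"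
  using ip_scaleR_left[of "-1" x y] by simp

lemma ip_minus_right: "ip x (- y) = - ip x y"
  using ip_scaleR_right[of x "-1" y] by simp

lemma ip_diff_left: "ip (x - y) z = ip x z - ip y z"
  using ip_add_left[of x "- y" z] by (simp add: ip_minus_left)

lemma ip_diff_right: "ip x (y - z) = ip x y - ip x z"
  using ip_add_right[of x y "- z"] by (simp add: ip_minus_right)

lemma ip_sum_left: "ip (sum f I) y = (\<Sum>i\<in>I. ip (f i) y)"
  by (induction I rule: infinite_finite_induct) (simp_all add: ip_add_left)

lemma ip_sum_right: "ip y (sum f I) = (\<Sum>i\<in>I. ip y (f i))"
  by (induction I rule: infinite_finite_induct) (simp_all add: ip_add_right)

lemma norm_ip_self: "norm (ip x x) = (norm x)\<^sup>2"
  by (simp add: norm_ip)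

text \<open>The sort of \<open>'h\<close> ties the norm to real scaling only; complex scaling is
  controlled through the inner product.\<close>

lemma norm_scaleC_module: "norm (c *\<^sub>C x) = cmod c * norm x" for x :: 'h
proof -
  have "ip (c *\<^sub>C x) (c *\<^sub>C x) = (cnj c * c) *\<^sub>C ip x x"
    by (metis ip_scaleC_right scaleC_scaleC star_ip star_scaleC)
  then have "norm (ip (c *\<^sub>C x) (c *\<^sub>C x)) = cmod (cnj c * c) * norm (ip x x)"
    by (simp only: norm_scaleC)
  then have "(norm (c *\<^sub>C x))\<^sup>2 = (cmod c * norm x)\<^sup>2"
    by (simp add: norm_ip_self norm_mult power2_eq_square)
  then show ?thesis by (simp add: power2_eq_iff_nonneg)
qed

lemma norm_act_le: "norm (act x a) \<le> norm x * norm a"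
proof (rule power2_le_imp_le)
  have "(norm (act x a))\<^sup>2 = norm (star a * (ip x x * a))"
    by (simp add: ip_act_left ip_act_right mult.assoc flip: norm_ip_self)
  also have "\<dots> \<le> norm (star a) * (norm (ip x x) * norm a)"
    by (intro order_trans[OF norm_mult_ineq] mult_left_mono norm_mult_ineq) simp
  finally show "(norm (act x a))\<^sup>2 \<le> (norm x * norm a)\<^sup>2"
    by (simp add: norm_ip_self power2_eq_square mult_ac)
qed simp

lemma cpos_ip: "cpos (ip x x)"
  by (rule cpos_if_cstar_positive) (rule ip_positive)

text \<open>Expand the inner square of w = k y - x a for k = norm x squared and a =
  \<open>ip x y\<close>. By \<open>cpos_norm_conj\<close>, a^* \<open>ip x x\<close> a is at most k
  a^* a; what remains is k times the claim.\<close>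

lemma cpos_cauchy_schwarz: "cpos ((norm x)\<^sup>2 *\<^sub>R ip y y - ip y x * ip x y)"
proof (cases "x = 0")
  case True
  then show ?thesis by simp
next
  case False
  define k where "k = (norm x)\<^sup>2"
  define a where "a = ip x y"
  define w where "w = k *\<^sub>R y - act x a"
  have k: "k > 0" using False by (simp add: k_def)
  have sa: "star a = ip y x" by (simp add: a_def star_ip)
  have w: "ip w w = k *\<^sub>R (k *\<^sub>R ip y y - star a * a) - k *\<^sub>R (star a * a) + star a * ip x x * a"
    by (simp add: w_def ip_diff_left ip_diff_right ip_scaleR_left ip_scaleR_right ip_act_left
        ip_act_right scaleR_diff_right left_diff_distrib mult.assoc flip: a_def sa)
  have "cpos (k *\<^sub>R (star a * a) - star a * ip x x * a)"
    using cpos_norm_conj[OF star_ip, of x a] by (simp add: norm_ip_self k_def)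
  from cpos_add[OF cpos_ip[of w] this]
  have "cpos (k *\<^sub>R (k *\<^sub>R ip y y - star a * a))" unfolding w by simp
  then have "cpos (inverse k *\<^sub>R (k *\<^sub>R (k *\<^sub>R ip y y - star a * a)))"
    by (rule cpos_scaleR) (use k in simp)
  then show ?thesis using k by (simp add: k_def a_def sa star_ip)
qed

end

section \<open>Powers of a positive contraction\<close>

locale positive_contraction = hilbert_module act ip
  for act :: "'h::{banach, complex_vector} \<Rightarrow> 'a::cstar_algebra \<Rightarrow> 'h" and ip :: "'h \<Rightarrow> 'h \<Rightarrow> 'a" +
  fixes h :: "'h \<Rightarrow> 'h"
  assumes h_add: "h (x + y) = h x + h y"
    and h_act: "h (act x a) = act (h x) a"
    and h_scaleC: "h (c *\<^sub>C x) = c *\<^sub>C h x"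
    and h_symmetric: "ip (h x) y = ip x (h y)"
    and h_nonneg: "cpos (ip x (h x))"
    and h_le_one: "cpos (ip x (x - h x))"
begin

definition g :: "'h \<Rightarrow> 'h" where "g x = x - h x"

text \<open>The even exponent makes \<open>ip x ((g ^^ (2 * n)) x)\<close> the inner square of
  \<open>(g ^^ n) x\<close>, so it is positive by symmetry of \<open>g\<close> alone.\<close>

definition e :: "nat \<Rightarrow> 'h \<Rightarrow> 'h" where "e n x = x - (g ^^ (2 * n)) x"

lemma h_scaleR: "h (r *\<^sub>R x) = r *\<^sub>R h x"
  by (simp add: scaleR_scaleC h_scaleC)

lemma h_diff: "h (x - y) = h x - h y"
  using h_add[of x "- y"] h_scaleR[of "-1" y] by simp

lemma g_add: "g (x + y) = g x + g y"
  by (simp add: g_def h_add)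

lemma g_act: "g (act x a) = act (g x) a"
  by (simp add: g_def h_act act_diff_left)

lemma g_scaleC: "g (c *\<^sub>C x) = c *\<^sub>C g x"
  by (simp add: g_def h_scaleC complex_module.scale_right_diff_distrib)

lemma g_symmetric: "ip (g x) y = ip x (g y)"
  by (simp add: g_def ip_diff_left ip_diff_right h_symmetric)

lemma g_power_symmetric: "ip ((g ^^ n) x) y = ip x ((g ^^ n) y)"
  by (induction n arbitrary: x y) (simp_all add: g_symmetric funpow_swap1)

lemma e_add: "e n (x + y) = e n x + e n y"
proof -
  have "(g ^^ m) (x + y) = (g ^^ m) x + (g ^^ m) y" for m
    by (induction m) (simp_all add: g_add)
  then show ?thesis by (simp add: e_def)
qed

lemma e_act: "e n (act x a) = act (e n x) a"
proof -
  have "(g ^^ m) (act x a) = act ((g ^^ m) x) a" for m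
    by (induction m) (simp_all add: g_act)
  then show ?thesis by (simp add: e_def act_diff_left)
qed

lemma e_scaleC: "e n (c *\<^sub>C x) = c *\<^sub>C e n x"
proof -
  have "(g ^^ m) (c *\<^sub>C x) = c *\<^sub>C (g ^^ m) x" for m
    by (induction m) (simp_all add: g_scaleC)
  then show ?thesis by (simp add: e_def complex_module.scale_right_diff_distrib)
qed

text \<open>Since \<open>h + g = 1\<close>, we have \<open>h g = g h g + h g h\<close>.\<close>

lemma cpos_hg: "cpos (ip (h x) (g x))"
proof -
  have "ip (h x) (g x) = ip (g x) (h (g x)) + ip (h x) (h x - h (h x))"
    by (simp add: g_def h_diff ip_diff_left ip_diff_right h_symmetric)
  then show ?thesis by (metis cpos_add h_nonneg h_le_one)
qed

text \<open>As operators, 1 - g^2 - h = h g. This is one step of the telescoping in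
  \<open>norm_ip_h_g_power\<close>.\<close>

lemma g_decreasing: "cpos (ip x x - ip (g x) (g x) - ip x (h x))"
proof -
  have "ip x x - ip (g x) (g x) - ip x (h x) = ip (h x) (g x)"
    by (simp add: g_def ip_diff_left ip_diff_right h_symmetric)
  then show ?thesis using cpos_hg by simp
qed

lemma g_contraction: "cpos (ip x x - ip (g x) (g x))"
  using cpos_add[OF g_decreasing[of x] h_nonneg[of x]] by simp

text \<open>As operators, h - g h g = h^2 + h (1 - h) h.\<close>

lemma h_g_decreasing: "cpos (ip x (h x) - ip (g x) (h (g x)))"
proof -
  have "ip x (h x) - ip (g x) (h (g x)) = ip (h x) (h x) + ip (h x) (h x - h (h x))"
    by (simp add: g_def h_diff ip_diff_left ip_diff_right h_symmetric)
  then show ?thesis by (metis cpos_add cpos_ip h_le_one)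
qed

lemma g_power_contraction: "cpos (ip x x - ip ((g ^^ n) x) ((g ^^ n) x))"
proof (induction n)
  case (Suc n)
  from cpos_add[OF Suc g_contraction[of "(g ^^ n) x"]] show ?case by simp
qed simp

text \<open>As operators, 1 - (1 - g^2n)^2 = g^2n + (g^2n - g^4n), a sum of two positive
  terms.\<close>

lemma norm_e_le: "norm (e n x) \<le> norm x"
proof -
  define z where "z = (g ^^ n) x"
  define w where "w = (g ^^ n) z"
  have w: "(g ^^ (2 * n)) x = w"
    by (simp add: z_def w_def mult_2 funpow_add)
  have "ip x w = ip z z" "ip w x = ip z z"
    unfolding w_def by (simp_all add: z_def flip: g_power_symmetric)
  then have "ip x x - ip (e n x) (e n x) = ip z z + (ip z z - ip w w)"
    by (simp add: e_def w ip_diff_left ip_diff_right)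
  then have "cpos (ip x x - ip (e n x) (e n x))"
    unfolding w_def by (metis cpos_add cpos_ip g_power_contraction)
  then have "norm (ip (e n x) (e n x)) \<le> norm (ip x x)"
    using cpos_ip norm_mono_cpos by blast
  then show ?thesis by (intro power2_le_imp_le[OF _ norm_ge_zero]) (simp add: norm_ip_self)
qed

text \<open>In the notation of the proof, a_k - a_(k+1) dominates b_k, which dominates b_n for k <
  n. Summing over k < n bounds n b_n by a_0 - a_n.\<close>

lemma norm_ip_h_g_power:
  "real n * norm (ip ((g ^^ n) x) (h ((g ^^ n) x))) \<le> (norm x)\<^sup>2"
proof -
  define a b where "a n = ip ((g ^^ n) x) ((g ^^ n) x)" and "b n = ip ((g ^^ n) x) (h ((g ^^ n) x))" for n
  have a_decr: "cpos (a n - a (Suc n) - b n)" for n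
    using g_decreasing[of "(g ^^ n) x"] by (simp add: a_def b_def)
  have b_decr: "cpos (b n - b (Suc n))" for n
    using h_g_decreasing[of "(g ^^ n) x"] by (simp add: b_def)
  have "cpos (a 0 - a n - real n *\<^sub>R b n)" for n
  proof (induction n)
    case (Suc n)
    have "a 0 - a (Suc n) - real (Suc n) *\<^sub>R b (Suc n)
      = (a 0 - a n - real n *\<^sub>R b n) + ((a n - a (Suc n) - b n) + real (Suc n) *\<^sub>R (b n - b (Suc n)))"
      by (simp add: algebra_simps)
    also have "cpos \<dots>"
      by (intro cpos_add Suc a_decr cpos_scaleR b_decr) simp
    finally show ?case .
  qed simp
  from cpos_add[OF this[of n] cpos_ip[of "(g ^^ n) x"]]
  have "cpos (a 0 - real n *\<^sub>R b n)" by (simp add: a_def)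
  moreover have "cpos (real n *\<^sub>R b n)" unfolding b_def by (intro cpos_scaleR h_nonneg) simp
  ultimately have "norm (real n *\<^sub>R b n) \<le> norm (a 0)" using norm_mono_cpos by blast
  then show ?thesis by (simp add: a_def b_def norm_ip_self)
qed

text \<open>If \<open>t \<theta>\<^bsub>x,x\<^esub> \<le> h\<close>, then \<open>t a\<^sup>* a \<le> \<langle>g\<^bsup>2n\<^esup> x, h g\<^bsup>2n\<^esup> x\<rangle>\<close> for
  \<open>a = \<langle>x, g\<^bsup>2n\<^esup> x\<rangle> = \<langle>g\<^sup>n x, g\<^sup>n x\<rangle>\<close>.\<close>

lemma e_tendsto:
  assumes t: "t > 0" and x: "\<And>y. cpos (ip y (h y) - t *\<^sub>R (ip y x * ip x y))"
  shows "(\<lambda>n. e n x) \<longlonglongrightarrow> x"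
proof -
  \<comment> \<open>The fourth power appears because the norm of a^* a is that of \<open>a\<close>
    squared, and \<open>a\<close> is itself the inner square of \<open>(g ^^ n) x\<close>.\<close>
  have bound: "t * (norm ((g ^^ n) x)) ^ 4 * real (2 * n) \<le> (norm x)\<^sup>2" for n
  proof -
    define y where "y = (g ^^ (2 * n)) x"
    define a where "a = ip x y"
    have "a = ip ((g ^^ n) x) ((g ^^ n) x)"
      by (simp add: a_def y_def mult_2 funpow_add g_power_symmetric)
    then have na: "norm a = (norm ((g ^^ n) x))\<^sup>2" by (simp add: norm_ip_self)
    have sa: "star a * a = ip y x * ip x y" by (simp add: a_def star_ip)
    have "cpos (t *\<^sub>R (star a * a))"
      using t by (intro cpos_scaleR cpos_star_mult) simp
    then have "norm (t *\<^sub>R (star a * a)) \<le> norm (ip y (h y))"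
      using x[of y] norm_mono_cpos unfolding sa by blast
    then have "t * (norm a)\<^sup>2 \<le> norm (ip y (h y))"
      using t by (simp add: norm_star_mult)
    then have "t * (norm a)\<^sup>2 * real (2 * n) \<le> real (2 * n) * norm (ip y (h y))"
      by (metis mult.commute mult_left_mono of_nat_0_le_iff)
    also have "\<dots> \<le> (norm x)\<^sup>2" unfolding y_def by (rule norm_ip_h_g_power)
    finally show ?thesis by (simp add: na)
  qed
  have small: "(\<lambda>n. (norm ((g ^^ n) x)) ^ 4) \<longlonglongrightarrow> 0"
  proof (rule Lim_null_comparison)
    show "eventually (\<lambda>n. norm (norm ((g ^^ n) x) ^ 4) \<le> (norm x)\<^sup>2 / (2 * t) * inverse (real n)) sequentially"
      using eventually_gt_at_top[of 0]
    proof eventually_elim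
      case (elim n)
      with bound[of n] t show ?case by (simp add: field_simps)
    qed
    show "(\<lambda>n. (norm x)\<^sup>2 / (2 * t) * inverse (real n)) \<longlonglongrightarrow> 0"
      by (intro tendsto_mult_right_zero lim_inverse_n)
  qed
  have "(\<lambda>n. root 4 (norm ((g ^^ n) x) ^ 4)) \<longlonglongrightarrow> root 4 0"
    by (intro tendsto_real_root small)
  then have "(\<lambda>n. norm ((g ^^ n) x)) \<longlonglongrightarrow> 0"
    by (simp add: real_root_power_cancel)
  then have "(\<lambda>n. (g ^^ n) x) \<longlonglongrightarrow> 0" by (rule tendsto_norm_zero_cancel)
  then have "(\<lambda>n. (g ^^ (2 * n)) x) \<longlonglongrightarrow> 0"
    by (rule LIMSEQ_subseq_LIMSEQ[unfolded o_def]) (simp add: strict_mono_def)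
  from tendsto_diff[OF tendsto_const[of x] this] show ?thesis by (simp add: e_def)
qed

text \<open>1 - g^m is a polynomial in \<open>h\<close> without constant term, so its range stays
  where \<open>h\<close> maps.\<close>

lemma e_in:
  assumes S: "0 \<in> S" "\<And>x y. x \<in> S \<Longrightarrow> y \<in> S \<Longrightarrow> x + y \<in> S" "\<And>x c. x \<in> S \<Longrightarrow> c *\<^sub>C x \<in> S"
    and h: "\<And>x. h x \<in> S"
  shows "e n x \<in> S"
proof -
  have "x - (g ^^ m) x \<in> S" for m
  proof (induction m)
    case (Suc m)
    have "x - (g ^^ Suc m) x = (x - (g ^^ m) x) + h ((g ^^ m) x)" by (simp add: g_def)
    then show ?case using S(2)[OF Suc h] by metis
  qed (simp add: S)
  then show ?thesis by (simp add: e_def)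
qed

end

section \<open>Approximate units of submodules\<close>

lemma submodule_approximate_unit:
  fixes act :: "'h::{banach, complex_vector} \<Rightarrow> 'a::cstar_algebra \<Rightarrow> 'h"
  assumes "hilbert_module act ip" and S: "hilbert_submodule act S"
    and F: "finite F" "F \<subseteq> S" and \<epsilon>: "\<epsilon> > 0"
  obtains e where "bounded_module_map_on act act UNIV e" "\<And>x. norm (e x) \<le> norm x"
    "\<And>x. e x \<in> S" "\<And>x. x \<in> F \<Longrightarrow> norm (e x - x) < \<epsilon>"
proof -
  interpret hilbert_module act ip by fact
  \<comment> \<open>The summand 1 keeps \<open>t\<close> positive when \<open>F\<close> is empty or
    contains only 0.\<close>
  define t where "t = inverse (1 + (\<Sum>x\<in>F. (norm x)\<^sup>2))"
  have "0 \<le> (\<Sum>x\<in>F. (norm x)\<^sup>2)" by (simp add: sum_nonneg)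
  then have t: "t > 0" "1 - t * (\<Sum>x\<in>F. (norm x)\<^sup>2) \<ge> 0"
    unfolding t_def by (simp_all add: field_simps)
  define h where "h y = t *\<^sub>R (\<Sum>x\<in>F. act x (ip x y))" for y
  have ip_h: "ip y (h y) = t *\<^sub>R (\<Sum>x\<in>F. ip y x * ip x y)" for y
    by (simp add: h_def ip_scaleR_right ip_sum_right ip_act_right)
  have cpos_term: "cpos (ip y x * ip x y)" for x y
    by (metis cpos_star_mult star_ip)
  interpret positive_contraction act ip h
  proof
    show "h (x + y) = h x + h y" for x y
      by (simp add: h_def ip_add_right act_add_right sum.distrib scaleR_add_right)
    show "h (act x a) = act (h x) a" for x a
      by (simp add: h_def ip_act_right act_mult act_sum_left act_scaleR_left)
    show "h (c *\<^sub>C x) = c *\<^sub>C h x" for c x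
      by (simp add: h_def ip_scaleC_right act_scaleC_right scaleC_scaleR_commute
          complex_module.scale_sum_right)
    show "ip (h x) y = ip x (h y)" for x y
      by (simp add: h_def ip_scaleR_left ip_scaleR_right ip_sum_left ip_sum_right ip_act_left
          ip_act_right star_ip)
    show "cpos (ip x (h x))" for x
      unfolding ip_h using t(1) by (intro cpos_scaleR cpos_sum cpos_term) simp
    show "cpos (ip y (y - h y))" for y
    proof -
      \<comment> \<open>Splitting 1 as t times the sum of the squared norms plus a nonnegative rest
        lets Cauchy-Schwarz apply to each vector of \<open>F\<close>.\<close>
      have "ip y (y - h y) = t *\<^sub>R (\<Sum>x\<in>F. (norm x)\<^sup>2 *\<^sub>R ip y y - ip y x * ip x y)
          + (1 - t * (\<Sum>x\<in>F. (norm x)\<^sup>2)) *\<^sub>R ip y y"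
        by (simp add: ip_diff_right ip_h sum_subtractf scaleR_diff_right scaleR_diff_left
            flip: scaleR_left.sum)
      also have "cpos \<dots>"
        using t by (intro cpos_add cpos_scaleR cpos_sum cpos_cauchy_schwarz cpos_ip) auto
      finally show ?thesis .
    qed
  qed
  have "(\<lambda>n. e n x) \<longlonglongrightarrow> x" if "x \<in> F" for x
  proof (rule e_tendsto[OF t(1)])
    fix y
    have "ip y (h y) - t *\<^sub>R (ip y x * ip x y) = t *\<^sub>R (\<Sum>z\<in>F - {x}. ip y z * ip z y)"
      unfolding ip_h sum.remove[OF F(1) that] by (simp add: scaleR_add_right)
    also have "cpos \<dots>"
      using t(1) by (intro cpos_scaleR cpos_sum cpos_term) simp
    finally show "cpos (ip y (h y) - t *\<^sub>R (ip y x * ip x y))" .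
  qed
  then have "\<forall>x\<in>F. eventually (\<lambda>n. dist (e n x) x < \<epsilon>) sequentially"
    using \<epsilon> tendstoD by blast
  then have "eventually (\<lambda>n. \<forall>x\<in>F. dist (e n x) x < \<epsilon>) sequentially"
    by (rule eventually_ball_finite[OF F(1)])
  then obtain n where n: "\<And>x. x \<in> F \<Longrightarrow> norm (e n x - x) < \<epsilon>"
    unfolding eventually_sequentially dist_norm by blast
  have S': "0 \<in> S" "\<And>x y. x \<in> S \<Longrightarrow> y \<in> S \<Longrightarrow> x + y \<in> S" "\<And>x c. x \<in> S \<Longrightarrow> c *\<^sub>C x \<in> S"
    "\<And>x a. x \<in> S \<Longrightarrow> act x a \<in> S"
    using S by (auto simp: hilbert_submodule_def)
  have sumS: "sum f I \<in> S" if "\<And>i. i \<in> I \<Longrightarrow> f i \<in> S" for f :: "'h \<Rightarrow> 'h" and I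
    using that by (induction I rule: infinite_finite_induct) (auto intro: S')
  have "h y \<in> S" for y
    unfolding h_def scaleR_scaleC using F(2) by (intro S' sumS) auto
  then have "e n x \<in> S" for x
    by (intro e_in S') auto
  moreover have "bounded_module_map_on act act UNIV (e n)"
    unfolding bounded_module_map_on_def
    by (auto simp: e_add e_act e_scaleC intro!: exI[of _ 1] norm_e_le)
  ultimately show thesis using that[of "e n"] n norm_e_le by blast
qed

text \<open>Convergence on the generators passes to their multiples because the maps are module
  maps, to the span by linearity, and to the closure by the uniform bound 1.\<close>

lemma submodule_sequential_approximate_unit:
  fixes act :: "'h::{banach, complex_vector} \<Rightarrow> 'a::cstar_algebra \<Rightarrow> 'h"
  assumes H: "hilbert_module act ip" and S: "hilbert_submodule act S"
    and gen: "countably_generated act S"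
  obtains e where "\<And>n :: nat. bounded_module_map_on act act UNIV (e n)"
    "\<And>n x. norm (e n x) \<le> norm x" "\<And>n x. e n x \<in> S" "\<And>x. x \<in> S \<Longrightarrow> (\<lambda>n. e n x) \<longlonglongrightarrow> x"
proof -
  interpret hilbert_module act ip by (rule H)
  obtain G where G: "G \<subseteq> S" "countable G"
      "S \<subseteq> closure (complex_module.span {act z a |z a. z \<in> G})"
    using gen by (auto simp: countably_generated_def)
  \<comment> \<open>Inserting 0 permits an enumeration even when \<open>G\<close> is empty.\<close>
  define z where "z = from_nat_into (insert 0 G)"
  have "0 \<in> S" using S by (simp add: hilbert_submodule_def)
  then have z: "range z = insert 0 G" "range z \<subseteq> S"
    using G by (simp_all add: z_def range_from_nat_into)
  have z_in: "z n \<in> S" for n using z(2) by blast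
  \<comment> \<open>The n-th map is accurate to 1/(n+1) on the generators with index at most n, so
    each generator is handled by all but finitely many maps.\<close>
  have "\<exists>f. bounded_module_map_on act act UNIV f \<and> (\<forall>x. norm (f x) \<le> norm x) \<and> (\<forall>x. f x \<in> S) \<and>
      (\<forall>x\<in>z ` {..n}. norm (f x - x) < inverse (real (Suc n)))" for n
  proof -
    have "finite (z ` {..n})" "z ` {..n} \<subseteq> S" "0 < inverse (real (Suc n))"
      using z_in by auto
    from submodule_approximate_unit[OF H S this] show ?thesis by metis
  qed
  then obtain e where e: "\<And>n. bounded_module_map_on act act UNIV (e n)"
      "\<And>n x. norm (e n x) \<le> norm x" "\<And>n x. e n x \<in> S"
      "\<And>n x. x \<in> z ` {..n} \<Longrightarrow> norm (e n x - x) < inverse (real (Suc n))"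
    by metis
  have e_add: "e n (x + y) = e n x + e n y" and e_scaleC: "e n (c *\<^sub>C x) = c *\<^sub>C e n x"
    and e_act: "e n (act x a) = act (e n x) a" for n x y c a
    using e(1)[of n] by (auto simp: bounded_module_map_on_def)
  define T where "T = {x. (\<lambda>n. e n x - x) \<longlonglongrightarrow> 0}"
  have bl_scaleC: "bounded_linear (\<lambda>x::'h. c *\<^sub>C x)" for c
  proof (rule bounded_linear_intro)
    show "norm (c *\<^sub>C x) \<le> norm x * cmod c" for x :: 'h
      by (simp add: norm_scaleC_module)
  qed (simp_all add: scaleC_add_right scaleC_scaleR_commute)
  have "{act x a |x a. x \<in> G} \<subseteq> T"
  proof clarify
    fix x a assume "x \<in> G"
    then obtain k where k: "x = z k" using z by blast
    have x: "(\<lambda>n. e n x - x) \<longlonglongrightarrow> 0"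
    proof (rule Lim_null_comparison[OF _ LIMSEQ_inverse_real_of_nat])
      show "eventually (\<lambda>n. norm (e n x - x) \<le> inverse (real (Suc n))) sequentially"
        using eventually_ge_at_top[of k]
        by eventually_elim (use k e(4) in \<open>auto intro!: less_imp_le\<close>)
    qed
    have "(\<lambda>n. act (e n x - x) a) \<longlonglongrightarrow> 0"
    proof (rule Lim_null_comparison[OF always_eventually], rule allI)
      show "norm (act (e n x - x) a) \<le> norm (e n x - x) * norm a" for n
        by (rule norm_act_le)
      show "(\<lambda>n. norm (e n x - x) * norm a) \<longlonglongrightarrow> 0"
        by (intro tendsto_mult_left_zero tendsto_norm_zero x)
    qed
    then show "act x a \<in> T" by (simp add: T_def e_act act_diff_left)
  qed
  moreover have "complex_module.subspace T"
  proof (rule complex_module.subspaceI)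
    have "e n 0 = 0" for n using e(2)[of n 0] by simp
    then show "0 \<in> T" by (simp add: T_def)
    show "x + y \<in> T" if "x \<in> T" "y \<in> T" for x y
      using tendsto_add[of _ 0 _ _ 0] that by (fastforce simp: T_def e_add algebra_simps)
    show "c *\<^sub>C x \<in> T" if "x \<in> T" for c x
      using bounded_linear.tendsto_zero[OF bl_scaleC, of _ _ c] that
      by (fastforce simp: T_def e_scaleC complex_module.scale_right_diff_distrib)
  qed
  ultimately have span: "complex_module.span {act x a |x a. x \<in> G} \<subseteq> T"
    by (rule complex_module.span_minimal)
  have "(\<lambda>n. e n x) \<longlonglongrightarrow> x" if x: "x \<in> S" for x
  proof (rule tendstoI)
    fix \<epsilon> :: real assume "\<epsilon> > 0"
    have "x \<in> closure T" using x G(3) closure_mono[OF span] by blast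
    moreover have "\<epsilon> / 3 > 0" using \<open>\<epsilon> > 0\<close> by simp
    ultimately have "\<exists>y\<in>T. dist y x < \<epsilon> / 3" unfolding closure_approachable by blast
    then obtain y where y: "y \<in> T" "dist y x < \<epsilon> / 3" by blast
    then have "(\<lambda>n. e n y - y) \<longlonglongrightarrow> 0" by (simp add: T_def)
    then have "eventually (\<lambda>n. norm (e n y - y) < \<epsilon> / 3) sequentially"
      using \<open>\<epsilon> > 0\<close> by (auto dest!: tendstoD[of _ 0 _ "\<epsilon> / 3"])
    then show "eventually (\<lambda>n. dist (e n x) x < \<epsilon>) sequentially"
    proof eventually_elim
      case (elim n)
      have "e n x - x = (e n (x - y) + (e n y - y)) + (y - x)"
        using e_add[of n "x - y" y] by simp
      then have "norm (e n x - x) \<le> norm (e n (x - y)) + norm (e n y - y) + norm (y - x)"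
        by (simp only:) (intro norm_triangle_le add_right_mono norm_triangle_ineq)
      also have "\<dots> < \<epsilon> / 3 + \<epsilon> / 3 + \<epsilon> / 3"
        using y(2) e(2)[of n "x - y"] elim by (simp add: dist_norm norm_minus_commute)
      finally show ?case by (simp add: dist_norm)
    qed
  qed
  with e show thesis by (intro that) auto
qed

section \<open>Operator norms and the approximate extension\<close>

lemma bdd_above_onorm_on:
  assumes "bounded_module_map_on act act' S f"
  shows "bdd_above ((\<lambda>x. norm (f x) / norm x) ` S)"
proof -
  have "\<exists>K. \<forall>x\<in>S. norm (f x) \<le> K * norm x"
    using assms by (simp add: bounded_module_map_on_def)
  then obtain K where K: "\<And>x. x \<in> S \<Longrightarrow> norm (f x) \<le> K * norm x" by blast
  show ?thesis
  proof (rule bdd_aboveI2)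
    fix x assume "x \<in> S"
    \<comment> \<open>\<open>K\<close> may be negative when 0 is the only element of
      \<open>S\<close>.\<close>
    have "norm (f x) \<le> \<bar>K\<bar> * norm x"
      using K[OF \<open>x \<in> S\<close>] by (rule order_trans) (simp add: mult_right_mono)
    then show "norm (f x) / norm x \<le> \<bar>K\<bar>"
      by (cases "x = 0") (simp_all add: field_simps)
  qed
qed

lemma norm_le_onorm_on:
  assumes "bounded_module_map_on act act' S f" "x \<in> S"
  shows "norm (f x) \<le> onorm_on S f * norm x"
proof (cases "x = 0")
  case True
  have "\<exists>K. \<forall>x\<in>S. norm (f x) \<le> K * norm x"
    using assms by (simp add: bounded_module_map_on_def)
  then show ?thesis using True assms(2) by fastforce
next
  case False
  have "norm (f x) / norm x \<le> onorm_on S f"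
    unfolding onorm_on_def using assms(2) bdd_above_onorm_on[OF assms(1)] by (rule cSUP_upper)
  then show ?thesis using False by (simp add: field_simps)
qed

text \<open>The quotient at 0 is 0 by the convention for division by zero, so 0 is among the values
  under the supremum.\<close>

lemma onorm_on_nonneg:
  assumes "bounded_module_map_on act act' S f" "0 \<in> S"
  shows "0 \<le> onorm_on S f"
  using cSUP_upper[OF assms(2) bdd_above_onorm_on[OF assms(1)]] by (simp add: onorm_on_def)

text \<open>Composition takes the place of extension: \<open>e\<close> moves every vector into the
  domain of \<open>f\<close> without increasing its norm.\<close>

lemma contraction_compose:
  assumes e: "bounded_module_map_on act1 act1 UNIV e" "\<And>x. norm (e x) \<le> norm x" "\<And>x. e x \<in> S"
    and f: "bounded_module_map_on act1 act2 S f" and "0 \<in> S"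
  shows "bounded_module_map_on act1 act2 UNIV (\<lambda>x. f (e x))"
    and "onorm_on UNIV (\<lambda>x. f (e x)) \<le> onorm_on S f"
proof -
  have le: "norm (f (e x)) \<le> onorm_on S f * norm x" for x
  proof -
    have "norm (f (e x)) \<le> onorm_on S f * norm (e x)"
      using f e(3) by (rule norm_le_onorm_on)
    also have "\<dots> \<le> onorm_on S f * norm x"
      using e(2) onorm_on_nonneg[OF f \<open>0 \<in> S\<close>] by (rule mult_left_mono)
    finally show ?thesis .
  qed
  then have "\<exists>K. \<forall>x. norm (f (e x)) \<le> K * norm x" by blast
  then show "bounded_module_map_on act1 act2 UNIV (\<lambda>x. f (e x))"
    using e(1,3) f by (simp add: bounded_module_map_on_def)
  have "norm (f (e x)) / norm x \<le> onorm_on S f" for x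
    using le[of x] onorm_on_nonneg[OF f \<open>0 \<in> S\<close>] by (cases "x = 0") (simp_all add: field_simps)
  then show "onorm_on UNIV (\<lambda>x. f (e x)) \<le> onorm_on S f"
    unfolding onorm_on_def[of UNIV] by (intro cSUP_least) auto
qed

lemma bounded_module_map_on_diff:
  assumes f: "bounded_module_map_on act act' S f" and S: "hilbert_submodule act S"
    and x: "x \<in> S" and y: "y \<in> S"
  shows "f (x - y) = f x - f y" "x - y \<in> S"
proof -
  have "(-1) *\<^sub>C y \<in> S" using S y unfolding hilbert_submodule_def by blast
  then have y': "- y \<in> S" by (simp add: complex_module.scale_minus_left scaleC_one)
  then show "x - y \<in> S" using S x unfolding hilbert_submodule_def by (metis diff_conv_add_uminus)
  then have "f ((x - y) + y) = f (x - y) + f y"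
    using f y unfolding bounded_module_map_on_def by blast
  then show "f (x - y) = f x - f y" by simp
qed

theorem theorem6p4:
  fixes act1 :: "'h1::{banach, complex_vector} \<Rightarrow> 'a::cstar_algebra \<Rightarrow> 'h1"
    and ip1 :: "'h1 \<Rightarrow> 'h1 \<Rightarrow> 'a"
    and act :: "'h::{banach, complex_vector} \<Rightarrow> 'a \<Rightarrow> 'h"
    and ip :: "'h \<Rightarrow> 'h \<Rightarrow> 'a"
    and H0 :: "'h1 set"
    and \<phi> :: "'h1 \<Rightarrow> 'h"
  assumes "hilbert_module act1 ip1"
    and "hilbert_module act ip"
    and "hilbert_submodule act1 H0"
    and "bounded_module_map_on act1 act H0 \<phi>"
  shows "(\<forall>\<epsilon>>0. \<forall>F. finite F \<and> F \<subseteq> H0 \<longrightarrow>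
            (\<exists>\<psi>. bounded_module_map_on act1 act UNIV \<psi> \<and>
                 onorm_on UNIV \<psi> \<le> onorm_on H0 \<phi> \<and>
                 (\<forall>x\<in>F. norm (\<psi> x - \<phi> x) < \<epsilon>)))
       \<and> (countably_generated act1 H0 \<longrightarrow>
            (\<exists>\<psi> :: nat \<Rightarrow> 'h1 \<Rightarrow> 'h.
                 (\<forall>n. bounded_module_map_on act1 act UNIV (\<psi> n) \<and>
                      onorm_on UNIV (\<psi> n) \<le> onorm_on H0 \<phi>) \<and>
                 (\<forall>x\<in>H0. (\<lambda>n. norm (\<psi> n x - \<phi> x)) \<longlonglongrightarrow> 0)))"
proof -
  have zero: "0 \<in> H0" using assms(3) by (simp add: hilbert_submodule_def)
  \<comment> \<open>The added 1 keeps \<open>M\<close> positive when \<open>\<phi>\<close> vanishes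
    on \<open>H0\<close>, so that division by \<open>M\<close> is legitimate.\<close>
  define M where "M = onorm_on H0 \<phi> + 1"
  have M: "M > 0" using onorm_on_nonneg[OF assms(4) zero] by (simp add: M_def)
  have close: "norm (\<phi> y - \<phi> x) \<le> M * norm (y - x)" if "x \<in> H0" "y \<in> H0" for x y
  proof -
    note diff = bounded_module_map_on_diff[OF assms(4,3) that(2,1)]
    have "norm (\<phi> y - \<phi> x) \<le> onorm_on H0 \<phi> * norm (y - x)"
      using norm_le_onorm_on[OF assms(4) diff(2)] diff(1) by simp
    also have "\<dots> \<le> M * norm (y - x)" by (intro mult_right_mono) (simp_all add: M_def)
    finally show ?thesis .
  qed
  have finite_case: "\<exists>\<psi>. bounded_module_map_on act1 act UNIV \<psi> \<and>
      onorm_on UNIV \<psi> \<le> onorm_on H0 \<phi> \<and> (\<forall>x\<in>F. norm (\<psi> x - \<phi> x) < \<epsilon>)"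
    if F: "\<epsilon> > 0" "finite F" "F \<subseteq> H0" for \<epsilon> F
  proof -
    have "\<epsilon> / M > 0" using F M by simp
    then obtain e where e: "bounded_module_map_on act1 act1 UNIV e" "\<And>x. norm (e x) \<le> norm x"
        "\<And>x. e x \<in> H0" "\<And>x. x \<in> F \<Longrightarrow> norm (e x - x) < \<epsilon> / M"
      using submodule_approximate_unit[OF assms(1,3) F(2,3)] by metis
    have "norm (\<phi> (e x) - \<phi> x) < \<epsilon>" if "x \<in> F" for x
    proof -
      have "norm (\<phi> (e x) - \<phi> x) \<le> M * norm (e x - x)"
        using that F(3) e(3) by (intro close) auto
      also have "\<dots> < \<epsilon>" using e(4)[OF that] M by (simp add: field_simps)
      finally show ?thesis .
    qed
    then show ?thesis
      using contraction_compose[OF e(1-3) assms(4) zero] by blast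
  qed
  have countable_case: "\<exists>\<psi> :: nat \<Rightarrow> 'h1 \<Rightarrow> 'h.
      (\<forall>n. bounded_module_map_on act1 act UNIV (\<psi> n) \<and> onorm_on UNIV (\<psi> n) \<le> onorm_on H0 \<phi>) \<and>
      (\<forall>x\<in>H0. (\<lambda>n. norm (\<psi> n x - \<phi> x)) \<longlonglongrightarrow> 0)"
    if gen: "countably_generated act1 H0"
  proof -
    obtain e where e: "\<And>n :: nat. bounded_module_map_on act1 act1 UNIV (e n)"
        "\<And>n x. norm (e n x) \<le> norm x" "\<And>n x. e n x \<in> H0"
        "\<And>x. x \<in> H0 \<Longrightarrow> (\<lambda>n. e n x) \<longlonglongrightarrow> x"
      using submodule_sequential_approximate_unit[OF assms(1,3) gen] by metis
    have "(\<lambda>n. norm (\<phi> (e n x) - \<phi> x)) \<longlonglongrightarrow> 0" if x: "x \<in> H0" for x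
    proof (rule Lim_null_comparison[OF always_eventually], rule allI)
      show "norm (norm (\<phi> (e n x) - \<phi> x)) \<le> M * norm (e n x - x)" for n
        using close[OF x e(3)] by simp
      show "(\<lambda>n. M * norm (e n x - x)) \<longlonglongrightarrow> 0"
        by (intro tendsto_mult_right_zero tendsto_norm_zero LIM_zero e(4) x)
    qed
    then show ?thesis
      using contraction_compose[OF e(1) e(2) e(3) assms(4) zero]
      by (intro exI[of _ "\<lambda>n x. \<phi> (e n x)"]) blast
  qed
  show ?thesis using finite_case countable_case by blast
qed

end
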